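(* Let $\mathcal{M}'\in\mathbb{K}^{I_1\times I_2\times I_3}$ and let $R\leq\min\{I_1,I_2\}$ be an integer; set $K=\min\{R_3(\mathcal{M}'),R\}$. Let $\mathcal{W}'\in\mathbb{K}^{I_1\times I_2\times I_3}$ be a tensor of multilinear rank $(R,R,K)$ (a multilinear rank $(R,R,K)$ approximation of $\mathcal{M}'$) and let $\mathcal{W}\in\mathbb{K}^{R\times R\times K}$ be an orthogonal compression of $\mathcal{W}'$. Let $\mathbf{U}\in\mathbb{K}^{K\times K}$ be unitary and $\mathcal{S}=\mathcal{W}\cdot_3\mathbf{U}$ with frontal slices $\mathbf{S}_k$. For each $i=1,\dots,\lfloor K/2\rfloor$ let $\epsilon_i\geq0$ be such that every matrix pencil in the open Frobenius ball of radius $\epsilon_i$ around $(\mathbf{S}_{2i-1},\mathbf{S}_{2i})$ is simple, and set $\epsilon=\|(\epsilon_1,\dots,\epsilon_{\lfloor K/2\rfloor})\|_2$. If there exists a tensor $\tilde{\mathcal{T}}'\in\mathbb{K}^{I_1\times I_2\times I_3}$ of $\mathbb{K}$-rank $R$ with $$\|\mathcal{M}'-\tilde{\mathcal{T}}'\|_{\mathrm{F}}<\epsilon-\|\mathcal{M}'-\mathcal{W}'\|_{\mathrm{F}},$$ then $\mathcal{M}'$ has a best $\mathbb{K}$-rank $R$ approximation and every best $\mathbb{K}$-rank $R$ approximation of $\mathcal{M}'$ has a unique CPD. Furthermore, the set of tensors $\mathcal{M}'$ satisfying these assumptions that do not have a unique best $\mathbb{K}$-rank $R$ approximation has Lebesgue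 measure zero.
   Context: $\mathbb{K}$ denotes $\mathbb{R}$ or $\mathbb{C}$. The $\mathbb{K}$-rank of a tensor is the least number of rank one tensors $\mathbf{a}\otimes\mathbf{b}\otimes\mathbf{c}$ (nonzero $\mathbb{K}$-vectors) summing to it; such a minimal sum is a CPD; a CPD is unique if any other CPD differs only by a common column permutation and column scalings of the factor matrices. A best $\mathbb{K}$-rank $R$ approximation of $\mathcal{M}$ is a tensor of $\mathbb{K}$-rank at most $R$ minimizing Frobenius distance to $\mathcal{M}$. Multilinear rank $(R_1,R_2,R_3)$: $R_i$ is the dimension of the span of the mode-$i$ fibers; $R_3(\mathcal{M}')$ is the third one. $\cdot_i\mathbf{U}$ applies $\mathbf{U}$ to every mode-$i$ fiber. An orthogonal compression of $\mathcal{W}'$ is $\mathcal{W}'\cdot_1\mathbf{V}_1^{\mathrm{H}}\cdot_2\mathbf{V}_2^{\mathrm{H}}\cdot_3\mathbf{V}_3^{\mathrm{H}}$ where $\mathbf{V}_i$ has orthonormal columns forming a basis of the span of the mode-$i$ fibers. A tensor in $\mathbb{K}^{R\times R\times L}$ with slices $\mathbf{W}_k$ is simple if some linear combination of its slices is invertible and $\det(\sum_k\gamma_k\mathbf{W}_k)$ factors as a product of $R$ pairwise non-proportional linear forms; a matrix pencil $(\mathbf{P},\mathbf{Q})$ is identified with the tensor in $\mathbb{K}^{R\times R\times 2}$ with slices $\mathbf{P},\mathbf{Q}$. *)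

theory Defs
  imports "HOL-Analysis.Analysis"
begin

text \<open>Scalars: K is R or C. We represent both inside the complex numbers:
  the boolean flag isreal selects K = R (real subset of C) or K = C.
  Vectors, matrices and third-order tensors are functions on nat indices
  (0-based) that vanish outside the index bounds.\<close>

type_synonym vec = "nat \<Rightarrow> complex"
type_synonym mat = "nat \<Rightarrow> nat \<Rightarrow> complex"
type_synonym tensor = "nat \<Rightarrow> nat \<Rightarrow> nat \<Rightarrow> complex"

definition Kfield :: "bool \<Rightarrow> complex set" where
  "Kfield isreal = (if isreal then \<real> else UNIV)"

definition vec_in :: "complex set \<Rightarrow> nat \<Rightarrow> vec \<Rightarrow> bool" where
  "vec_in F n v \<longleftrightarrow> (\<forall>i. if i < n then v i \<in> F else v i = 0)"

definition mat_in :: "complex set \<Rightarrow> nat \<Rightarrow> nat \<Rightarrow> mat \<Rightarrow> bool" where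
  "mat_in F m n A \<longleftrightarrow> (\<forall>i j. if i < m \<and> j < n then A i j \<in> F else A i j = 0)"

definition tensor_in :: "complex set \<Rightarrow> nat \<Rightarrow> nat \<Rightarrow> nat \<Rightarrow> tensor \<Rightarrow> bool" where
  "tensor_in F I1 I2 I3 T \<longleftrightarrow>
     (\<forall>i j k. if i < I1 \<and> j < I2 \<and> k < I3 then T i j k \<in> F else T i j k = 0)"

definition frob_dist :: "nat \<Rightarrow> nat \<Rightarrow> nat \<Rightarrow> tensor \<Rightarrow> tensor \<Rightarrow> real" where
  "frob_dist I1 I2 I3 A B =
     sqrt (\<Sum>i<I1. \<Sum>j<I2. \<Sum>k<I3. (cmod (A i j k - B i j k))\<^sup>2)"

definition cpd_sum :: "nat \<Rightarrow> (nat \<Rightarrow> vec) \<Rightarrow> (nat \<Rightarrow> vec) \<Rightarrow> (nat \<Rightarrow> vec) \<Rightarrow> tensor" where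
  "cpd_sum r a b c = (\<lambda>i j k. \<Sum>l<r. a l i * b l j * c l k)"

definition is_decomp :: "complex set \<Rightarrow> nat \<Rightarrow> nat \<Rightarrow> nat \<Rightarrow> nat \<Rightarrow>
    (nat \<Rightarrow> vec) \<Rightarrow> (nat \<Rightarrow> vec) \<Rightarrow> (nat \<Rightarrow> vec) \<Rightarrow> tensor \<Rightarrow> bool" where
  "is_decomp F I1 I2 I3 r a b c T \<longleftrightarrow>
     (\<forall>l<r. vec_in F I1 (a l) \<and> (\<exists>i. a l i \<noteq> 0) \<and> vec_in F I2 (b l) \<and> (\<exists>i. b l i \<noteq> 0) \<and>
            vec_in F I3 (c l) \<and> (\<exists>i. c l i \<noteq> 0)) \<and>
     T = cpd_sum r a b c"

definition krank :: "complex set \<Rightarrow> nat \<Rightarrow> nat \<Rightarrow> nat \<Rightarrow> tensor \<Rightarrow> nat" where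
  "krank F I1 I2 I3 T = (LEAST r. \<exists>a b c. is_decomp F I1 I2 I3 r a b c T)"

definition is_CPD :: "complex set \<Rightarrow> nat \<Rightarrow> nat \<Rightarrow> nat \<Rightarrow> tensor \<Rightarrow>
    (nat \<Rightarrow> vec) \<Rightarrow> (nat \<Rightarrow> vec) \<Rightarrow> (nat \<Rightarrow> vec) \<Rightarrow> bool" where
  "is_CPD F I1 I2 I3 T a b c \<longleftrightarrow> is_decomp F I1 I2 I3 (krank F I1 I2 I3 T) a b c T"

definition unique_CPD :: "complex set \<Rightarrow> nat \<Rightarrow> nat \<Rightarrow> nat \<Rightarrow> tensor \<Rightarrow> bool" where
  "unique_CPD F I1 I2 I3 T \<longleftrightarrow>
     (\<exists>a b c. is_CPD F I1 I2 I3 T a b c) \<and>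
     (\<forall>a b c a' b' c'. is_CPD F I1 I2 I3 T a b c \<and> is_CPD F I1 I2 I3 T a' b' c' \<longrightarrow>
        (\<exists>\<sigma> \<alpha> \<beta> \<gamma>. \<sigma> permutes {..<krank F I1 I2 I3 T} \<and>
           (\<forall>l<krank F I1 I2 I3 T.
              a' l = (\<lambda>i. \<alpha> l * a (\<sigma> l) i) \<and>
              b' l = (\<lambda>i. \<beta> l * b (\<sigma> l) i) \<and>
              c' l = (\<lambda>i. \<gamma> l * c (\<sigma> l) i))))"

definition best_approx :: "complex set \<Rightarrow> nat \<Rightarrow> nat \<Rightarrow> nat \<Rightarrow> nat \<Rightarrow> tensor \<Rightarrow> tensor \<Rightarrow> bool" where
  "best_approx F I1 I2 I3 R M T \<longleftrightarrow>
     tensor_in F I1 I2 I3 T \<and> krank F I1 I2 I3 T \<le> R \<and>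
     (\<forall>T'. tensor_in F I1 I2 I3 T' \<and> krank F I1 I2 I3 T' \<le> R \<longrightarrow>
        frob_dist I1 I2 I3 M T \<le> frob_dist I1 I2 I3 M T')"

definition mode1_fibers :: "nat \<Rightarrow> nat \<Rightarrow> nat \<Rightarrow> tensor \<Rightarrow> vec set" where
  "mode1_fibers I1 I2 I3 T = {(\<lambda>i. T i j k) | j k. j < I2 \<and> k < I3}"
definition mode2_fibers :: "nat \<Rightarrow> nat \<Rightarrow> nat \<Rightarrow> tensor \<Rightarrow> vec set" where
  "mode2_fibers I1 I2 I3 T = {(\<lambda>j. T i j k) | i k. i < I1 \<and> k < I3}"
definition mode3_fibers :: "nat \<Rightarrow> nat \<Rightarrow> nat \<Rightarrow> tensor \<Rightarrow> vec set" where
  "mode3_fibers I1 I2 I3 T = {(\<lambda>k. T i j k) | i j. i < I1 \<and> j < I2}"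

definition in_Kspan :: "complex set \<Rightarrow> vec set \<Rightarrow> vec \<Rightarrow> bool" where
  "in_Kspan F S v \<longleftrightarrow>
     (\<exists>(n::nat) c w. (\<forall>l<n. c l \<in> F \<and> w l \<in> S) \<and> v = (\<lambda>i. \<Sum>l<n. c l * w l i))"

definition span_dim :: "complex set \<Rightarrow> nat \<Rightarrow> vec set \<Rightarrow> nat" where
  "span_dim F n S = (LEAST d. \<exists>u. (\<forall>l<d. vec_in F n (u l)) \<and>
                                   (\<forall>v\<in>S. in_Kspan F (u ` {..<d}) v))"

definition mlrank :: "complex set \<Rightarrow> nat \<Rightarrow> nat \<Rightarrow> nat \<Rightarrow> tensor \<Rightarrow> nat \<times> nat \<times> nat" where
  "mlrank F I1 I2 I3 T =
     (span_dim F I1 (mode1_fibers I1 I2 I3 T), span_dim F I2 (mode2_fibers I1 I2 I3 T),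
      span_dim F I3 (mode3_fibers I1 I2 I3 T))"

definition orthonormal_cols :: "nat \<Rightarrow> nat \<Rightarrow> mat \<Rightarrow> bool" where
  "orthonormal_cols m n V \<longleftrightarrow>
     (\<forall>a<n. \<forall>b<n. (\<Sum>i<m. cnj (V i a) * V i b) = (if a = b then 1 else 0))"

definition onb_cols :: "complex set \<Rightarrow> nat \<Rightarrow> nat \<Rightarrow> mat \<Rightarrow> vec set \<Rightarrow> bool" where
  "onb_cols F m n V S \<longleftrightarrow>
     mat_in F m n V \<and> orthonormal_cols m n V \<and>
     (\<forall>a<n. in_Kspan F S (\<lambda>i. V i a)) \<and>
     (\<forall>v\<in>S. in_Kspan F {(\<lambda>i. V i a) | a. a < n} v)"

definition compress :: "nat \<Rightarrow> nat \<Rightarrow> nat \<Rightarrow> mat \<Rightarrow> mat \<Rightarrow> mat \<Rightarrow> tensor \<Rightarrow> tensor" where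
  "compress I1 I2 I3 V1 V2 V3 T =
     (\<lambda>a b c. \<Sum>i<I1. \<Sum>j<I2. \<Sum>k<I3. cnj (V1 i a) * cnj (V2 j b) * cnj (V3 k c) * T i j k)"

definition orth_compression :: "complex set \<Rightarrow> nat \<Rightarrow> nat \<Rightarrow> nat \<Rightarrow> tensor \<Rightarrow> tensor \<Rightarrow> bool" where
  "orth_compression F I1 I2 I3 W' W \<longleftrightarrow>
     (\<exists>V1 V2 V3.
        onb_cols F I1 (span_dim F I1 (mode1_fibers I1 I2 I3 W')) V1 (mode1_fibers I1 I2 I3 W') \<and>
        onb_cols F I2 (span_dim F I2 (mode2_fibers I1 I2 I3 W')) V2 (mode2_fibers I1 I2 I3 W') \<and>
        onb_cols F I3 (span_dim F I3 (mode3_fibers I1 I2 I3 W')) V3 (mode3_fibers I1 I2 I3 W') \<and>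
        W = compress I1 I2 I3 V1 V2 V3 W')"

definition unitary_K :: "complex set \<Rightarrow> nat \<Rightarrow> mat \<Rightarrow> bool" where
  "unitary_K F n U \<longleftrightarrow> mat_in F n n U \<and> orthonormal_cols n n U"

definition mode3_prod :: "nat \<Rightarrow> mat \<Rightarrow> tensor \<Rightarrow> tensor" where
  "mode3_prod K U W = (\<lambda>a b k. \<Sum>c<K. U k c * W a b c)"

definition det_n :: "nat \<Rightarrow> mat \<Rightarrow> complex" where
  "det_n n A = (\<Sum>p | p permutes {..<n}. of_int (sign p) * (\<Prod>i<n. A i (p i)))"

definition invertible_n :: "nat \<Rightarrow> mat \<Rightarrow> bool" where
  "invertible_n n A \<longleftrightarrow>
     (\<exists>B. \<forall>i<n. \<forall>j<n. (\<Sum>l<n. A i l * B l j) = (if i = j then 1 else 0) \<and>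
                      (\<Sum>l<n. B i l * A l j) = (if i = j then 1 else 0))"

definition slice_comb :: "nat \<Rightarrow> vec \<Rightarrow> tensor \<Rightarrow> mat" where
  "slice_comb L g T = (\<lambda>a b. \<Sum>k<L. g k * T a b k)"

definition simple_tensor :: "complex set \<Rightarrow> nat \<Rightarrow> nat \<Rightarrow> tensor \<Rightarrow> bool" where
  "simple_tensor F R L T \<longleftrightarrow>
     tensor_in F R R L T \<and>
     (\<exists>g. vec_in F L g \<and> invertible_n R (slice_comb L g T)) \<and>
     (\<exists>lf. (\<forall>r<R. vec_in F L (lf r)) \<and>
           (\<forall>r<R. \<forall>s<R. r \<noteq> s \<longrightarrow>
               \<not> (\<exists>c\<in>F. lf r = (\<lambda>k. c * lf s k)) \<and> \<not> (\<exists>c\<in>F. lf s = (\<lambda>k. c * lf r k))) \<and>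
           (\<forall>g. vec_in F L g \<longrightarrow>
               det_n R (slice_comb L g T) = (\<Prod>r<R. \<Sum>k<L. lf r k * g k)))"

definition pencil :: "mat \<Rightarrow> mat \<Rightarrow> tensor" where
  "pencil P Q = (\<lambda>a b k. if k = 0 then P a b else if k = 1 then Q a b else 0)"

definition tslice :: "tensor \<Rightarrow> nat \<Rightarrow> mat" where
  "tslice T k = (\<lambda>a b. T a b k)"

definition ball_simple :: "complex set \<Rightarrow> nat \<Rightarrow> mat \<Rightarrow> mat \<Rightarrow> real \<Rightarrow> bool" where
  "ball_simple F R P0 Q0 e \<longleftrightarrow>
     (\<forall>P Q. mat_in F R R P \<and> mat_in F R R Q \<and>
        sqrt (\<Sum>a<R. \<Sum>b<R. (cmod (P a b - P0 a b))\<^sup>2 + (cmod (Q a b - Q0 a b))\<^sup>2) < e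
        \<longrightarrow> simple_tensor F R 2 (pencil P Q))"

text \<open>The hypotheses of the theorem for a given tensor M' (slices 1-based S_{2i-1},S_{2i}
  for i = 1..floor(K/2) become 0-based slices 2i, 2i+1 for i < K div 2).\<close>
definition thm27_hyps :: "bool \<Rightarrow> nat \<Rightarrow> nat \<Rightarrow> nat \<Rightarrow> nat \<Rightarrow>
    tensor \<Rightarrow> tensor \<Rightarrow> tensor \<Rightarrow> mat \<Rightarrow> (nat \<Rightarrow> real) \<Rightarrow> bool" where
  "thm27_hyps isreal I1 I2 I3 R M' W' W U eps \<longleftrightarrow>
     (let F = Kfield isreal;
          K = min (span_dim F I3 (mode3_fibers I1 I2 I3 M')) R;
          S = mode3_prod K U W;
          \<epsilon> = sqrt (\<Sum>i<K div 2. (eps i)\<^sup>2)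
      in tensor_in F I1 I2 I3 M' \<and> tensor_in F I1 I2 I3 W' \<and>
         mlrank F I1 I2 I3 W' = (R, R, K) \<and>
         orth_compression F I1 I2 I3 W' W \<and>
         unitary_K F K U \<and>
         (\<forall>i < K div 2. eps i \<ge> 0 \<and> ball_simple F R (tslice S (2*i)) (tslice S (2*i+1)) (eps i)) \<and>
         (\<exists>T. tensor_in F I1 I2 I3 T \<and> krank F I1 I2 I3 T = R \<and>
              frob_dist I1 I2 I3 M' T < \<epsilon> - frob_dist I1 I2 I3 M' W'))"

text \<open>Lebesgue-null set of tensors in K^{I1 x I2 x I3}: contained in a null set of
  the Lebesgue (product) measure on K^{I1 I2 I3} (K = C is identified with R^2).\<close>
definition tensor_null :: "bool \<Rightarrow> nat \<Rightarrow> nat \<Rightarrow> nat \<Rightarrow> tensor set \<Rightarrow> bool" where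
  "tensor_null isreal I1 I2 I3 S \<longleftrightarrow>
     (let idx = {..<I1} \<times> {..<I2} \<times> {..<I3};
          tt = (\<lambda>f :: nat \<times> nat \<times> nat \<Rightarrow> complex. \<lambda>i j k.
                   if i < I1 \<and> j < I2 \<and> k < I3 then f (i, j, k) else 0)
      in if isreal then
           (\<exists>N \<in> null_sets (PiM idx (\<lambda>_. (lborel :: real measure))).
              {f \<in> space (PiM idx (\<lambda>_. (lborel :: real measure))).
                 tt (\<lambda>x. complex_of_real (f x)) \<in> S} \<subseteq> N)
         else
           (\<exists>N \<in> null_sets (PiM idx (\<lambda>_. (lborel :: complex measure))).
              {f \<in> space (PiM idx (\<lambda>_. (lborel :: complex measure))). tt f \<in> S} \<subseteq> N))"

end

theory Submission
  imports Defs "Jordan_Normal_Form.Determinant"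
begin

text \<open>Orthogonal compression does not increase distances, so by the pigeonhole principle every tensor
  \<open>T\<close> at least as close to \<open>M'\<close> as the given rank \<open>R\<close> tensor has a compressed pencil that is simple.
  In particular some combination \<open>G\<close> of the compressed slices \<open>X\<^sub>k\<close> of \<open>T\<close> is invertible.

  Existence: tensors of rank at most \<open>R\<close> with \<open>G\<close> invertible satisfy \<open>X\<^sub>j G\<^sup>-\<^sup>1 X\<^sub>k = X\<^sub>k G\<^sup>-\<^sup>1 X\<^sub>j\<close>, and
  their full slices are recovered from the \<open>X\<^sub>k\<close>. Both identities pass to limits. For a limit tensor
  the simple pencil supplies a basis of eigenvectors with distinct eigenvalues, which diagonalizes all
  the commuting matrices \<open>G\<^sup>-\<^sup>1 X\<^sub>k\<close> and so yields a decomposition into \<open>R\<close> terms.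

  Uniqueness of the CPD: the linear forms of the pencil are those given by the third factors, so these
  are pairwise non-parallel, while the first two factor matrices have full column rank.

  Null set: for any set \<open>X\<close>, the tensors with two nearest points in \<open>X\<close> that differ in a fixed
  coordinate direction by a fixed rational gap form a measurable set meeting each line in that
  direction at most once.\<close>

section \<open>Square matrices as functions\<close>

text \<open>In general the set of tensors of rank at most \<open>R\<close> is not closed, so a
  minimizing sequence may converge to a tensor of larger rank; ruling this out near
  \<open>M'\<close> is the obstacle. The threshold comes from |T - W'| \<le> |M' - T| + |M' - W'| <
  \<epsilon>: as \<epsilon>^2 is the sum of the squared radii, the compressed pencils of
  \<open>T\<close> cannot all leave their balls. Which pencil stays inside depends on
  \<open>T\<close>, so the algebra is stated for arbitrary weights of the slices. A limit tensor
  need not live in the fiber spaces of \<open>W'\<close>, so decomposing its compression would not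
  decompose the tensor itself; the reconstruction identity, whose outer factors keep one of the
  first two modes uncompressed, closes this gap. Simplicity over K supplies linear forms with
  coefficients in K, and with them eigenvectors and factors over K. For the last claim the
  exceptional set is merely covered by null sets, since its own measurability is unclear. The
  covering sets arise from monotonicity of the metric projection: when one entry of \<open>M\<close>
  moves along a line, the difference of its squared distances to two points changes
  linearly.\<close>

definition mm :: "nat \<Rightarrow> (nat \<Rightarrow> nat \<Rightarrow> complex) \<Rightarrow> (nat \<Rightarrow> nat \<Rightarrow> complex) \<Rightarrow> nat \<Rightarrow> nat \<Rightarrow> complex"
  where "mm n A B = (\<lambda>i j. \<Sum>l<n. A i l * B l j)"

definition right_inv :: "nat \<Rightarrow> (nat \<Rightarrow> nat \<Rightarrow> complex) \<Rightarrow> (nat \<Rightarrow> nat \<Rightarrow> complex) \<Rightarrow> bool"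
  where "right_inv n A B \<longleftrightarrow> (\<forall>i<n. \<forall>j<n. mm n A B i j = (if i = j then 1 else 0))"

abbreviation jnf_mat :: "nat \<Rightarrow> (nat \<Rightarrow> nat \<Rightarrow> complex) \<Rightarrow> complex Matrix.mat"
  where "jnf_mat n A \<equiv> Matrix.mat n n (\<lambda>(i, j). A i j)"

text \<open>Unlike an inverse, the adjugate is polynomial in the entries, hence continuous also
  where the determinant vanishes.\<close>

definition adjugate_n :: "nat \<Rightarrow> (nat \<Rightarrow> nat \<Rightarrow> complex) \<Rightarrow> nat \<Rightarrow> nat \<Rightarrow> complex"
  where "adjugate_n n A = (\<lambda>i j. adj_mat (jnf_mat n A) $$ (i, j))"

text \<open>Only the inner dimension is a parameter, so factors may be rectangular and associativity
  is an equality of functions without index bounds.\<close>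

lemma mm_assoc: "mm m (mm n A B) C = mm n A (mm m B C)"
  unfolding mm_def
  by (intro ext, simp add: sum_distrib_left sum_distrib_right mult.assoc, rule sum.swap)

lemma mm_cong:
  assumes "\<And>l. l < n \<Longrightarrow> A i l = A' i l" "\<And>l. l < n \<Longrightarrow> B l j = B' l j"
  shows "mm n A B i j = mm n A' B' i j"
  unfolding mm_def using assms by (intro sum.cong) auto

lemma right_inv_mult:
  assumes "right_inv n A B" "i < n"
  shows "mm n A (mm n B C) i j = C i j"
proof -
  have "mm n A (mm n B C) i j = mm n (mm n A B) C i j" by (simp add: mm_assoc)
  also have "\<dots> = (\<Sum>l<n. (if l = i then C l j else 0))"
    unfolding mm_def[of n "mm n A B"] using assms by (intro sum.cong) (auto simp: right_inv_def)
  also have "\<dots> = C i j" using assms(2) by simp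
  finally show ?thesis .
qed

lemma det_n_jnf: "det_n n A = Determinant.det (jnf_mat n A)"
proof -
  have "Determinant.det (jnf_mat n A) =
      (\<Sum>p | p permutes {0..<n}. signof p * (\<Prod>i = 0..<n. jnf_mat n A $$ (i, p i)))"
    by (rule det_def') simp
  also have "\<dots> = (\<Sum>p | p permutes {..<n}. of_int (sign p) * (\<Prod>i<n. A i (p i)))"
  proof (intro sum.cong)
    fix p assume p: "p \<in> {p. p permutes {..<n}}"
    have "(\<Prod>i = 0..<n. jnf_mat n A $$ (i, p i)) = (\<Prod>i<n. A i (p i))"
      unfolding lessThan_atLeast0
      using p permutes_in_image[of p "{..<n}"] by (intro prod.cong) auto
    then show "signof p * (\<Prod>i = 0..<n. jnf_mat n A $$ (i, p i)) =
        of_int (sign p) * (\<Prod>i<n. A i (p i))"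
      by simp
  qed (simp add: lessThan_atLeast0)
  finally show ?thesis by (simp add: det_n_def)
qed

lemma jnf_mat_mm: "jnf_mat n (mm n A B) = jnf_mat n A * jnf_mat n B"
  by (rule eq_matI) (auto simp: mm_def scalar_prod_def lessThan_atLeast0)

lemma det_n_mm: "det_n n (mm n A B) = det_n n A * det_n n B"
  unfolding det_n_jnf jnf_mat_mm by (rule det_mult) auto

lemma det_n_cong: "(\<And>i j. i < n \<Longrightarrow> j < n \<Longrightarrow> A i j = B i j) \<Longrightarrow> det_n n A = det_n n B"
  unfolding det_n_jnf by (rule arg_cong[of _ _ Determinant.det]) (rule eq_matI, auto)

lemma det_n_diag: "det_n n (\<lambda>i j. if i = j then d i else 0) = (\<Prod>i<n. d i)"
proof -
  have "Determinant.det (jnf_mat n (\<lambda>i j. if i = j then d i else 0)) =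
      prod_list (diag_mat (jnf_mat n (\<lambda>i j. if i = j then d i else 0)))"
    by (rule det_upper_triangular[of _ n]) (auto simp: upper_triangular_def)
  then show ?thesis
    unfolding det_n_jnf prod_list_diag_prod by (simp add: lessThan_atLeast0)
qed

lemma right_inv_det:
  assumes "right_inv n A B"
  shows "det_n n A * det_n n B = 1"
proof -
  have "det_n n (mm n A B) = det_n n (\<lambda>i j. if i = j then 1 else 0)"
    using assms by (intro det_n_cong) (auto simp: right_inv_def)
  then show ?thesis unfolding det_n_mm using det_n_diag[of n "\<lambda>_. 1"] by simp
qed

lemma adjugate_n:
  assumes "i < n" "j < n"
  shows "mm n A (adjugate_n n A) i j = (if i = j then det_n n A else 0)"
    and "mm n (adjugate_n n A) A i j = (if i = j then det_n n A else 0)"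
proof -
  have c: "jnf_mat n A \<in> carrier_mat n n" by simp
  note a = adj_mat[OF c]
  have "(jnf_mat n A * adj_mat (jnf_mat n A)) $$ (i, j) = mm n A (adjugate_n n A) i j"
    using a(1) assms by (auto simp: mm_def scalar_prod_def lessThan_atLeast0 adjugate_n_def)
  then show "mm n A (adjugate_n n A) i j = (if i = j then det_n n A else 0)"
    using assms unfolding a(2) by (auto simp: det_n_jnf split: if_splits)
  have "(adj_mat (jnf_mat n A) * jnf_mat n A) $$ (i, j) = mm n (adjugate_n n A) A i j"
    using a(1) assms by (auto simp: mm_def scalar_prod_def lessThan_atLeast0 adjugate_n_def)
  then show "mm n (adjugate_n n A) A i j = (if i = j then det_n n A else 0)"
    using assms unfolding a(3) by (auto simp: det_n_jnf split: if_splits)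
qed

lemma adjugate_n_inverse:
  assumes "det_n n A \<noteq> 0"
  shows "right_inv n A (\<lambda>i j. adjugate_n n A i j / det_n n A)"
    and "right_inv n (\<lambda>i j. adjugate_n n A i j / det_n n A) A"
proof -
  have "mm n A (\<lambda>i j. adjugate_n n A i j / det_n n A) i j = mm n A (adjugate_n n A) i j / det_n n A"
    and "mm n (\<lambda>i j. adjugate_n n A i j / det_n n A) A i j = mm n (adjugate_n n A) A i j / det_n n A"
    for i j by (simp_all add: mm_def sum_divide_distrib)
  then show "right_inv n A (\<lambda>i j. adjugate_n n A i j / det_n n A)"
    and "right_inv n (\<lambda>i j. adjugate_n n A i j / det_n n A) A"
    using assms adjugate_n[of _ n] by (auto simp: right_inv_def)
qed

lemma right_inv_unique:
  assumes "right_inv n H A" "right_inv n A B" "i < n" "j < n"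
  shows "H i j = B i j"
proof -
  have "B i j = mm n H (mm n A B) i j" using right_inv_mult[OF assms(1,3)] by simp
  also have "\<dots> = mm n H (\<lambda>i j. if i = j then 1 else 0) i j"
    using assms by (intro mm_cong) (auto simp: right_inv_def)
  also have "\<dots> = H i j" using assms by (simp add: mm_def if_distrib cong: if_cong)
  finally show ?thesis by simp
qed

text \<open>The adjugate quotient is a left inverse of \<open>A\<close>, and a left inverse agrees
  with any right inverse.\<close>

lemma right_inv_sym:
  assumes "right_inv n A B"
  shows "right_inv n B A"
proof -
  define H where "H = (\<lambda>i j. adjugate_n n A i j / det_n n A)"
  have "det_n n A \<noteq> 0" using right_inv_det[OF assms] by auto
  then have H: "right_inv n H A" unfolding H_def by (rule adjugate_n_inverse)
  show ?thesis
    unfolding right_inv_def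
  proof (intro allI impI)
    fix i j assume ij: "i < n" "j < n"
    have "mm n B A i j = mm n H A i j"
      using right_inv_unique[OF H assms] ij by (intro mm_cong) auto
    then show "mm n B A i j = (if i = j then 1 else 0)" using H ij by (auto simp: right_inv_def)
  qed
qed

lemma det_n_zero_kernel:
  assumes "det_n n A = 0"
  obtains v where "\<exists>i<n. v i \<noteq> 0" "\<And>i. i < n \<Longrightarrow> (\<Sum>j<n. A i j * v j) = 0"
proof -
  have "jnf_mat n A \<in> carrier_mat n n" by simp
  then obtain v where v: "v \<in> carrier_vec n" "v \<noteq> 0\<^sub>v n" "jnf_mat n A *\<^sub>v v = 0\<^sub>v n"
    using assms det_0_iff_vec_prod_zero_field unfolding det_n_jnf by blast
  have "\<exists>i<n. vec_index v i \<noteq> 0" using v(1,2) by (metis carrier_vecD eq_vecI index_zero_vec)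
  moreover have "(\<Sum>j<n. A i j * vec_index v j) = 0" if "i < n" for i
  proof -
    have "vec_index (jnf_mat n A *\<^sub>v v) i = (\<Sum>j<n. A i j * vec_index v j)"
      using that v(1) by (auto simp: scalar_prod_def lessThan_atLeast0)
    then show ?thesis using v(3) that by simp
  qed
  ultimately show ?thesis using that by blast
qed

text \<open>Each entry is a signed minor, a polynomial; the shifted indices skip one row and one
  column.\<close>

lemma continuous_on_adjugate_n:
  assumes "\<And>i j. continuous_on S (\<lambda>x. A x i j)" "i < n" "j < n"
  shows "continuous_on S (\<lambda>x. adjugate_n n (A x) i j)"
proof -
  have "mat_delete (jnf_mat n B) j i =
      jnf_mat (n - 1) (\<lambda>k l. B (if k < j then k else Suc k) (if l < i then l else Suc l))" for B
    unfolding mat_delete_def by (rule eq_matI) auto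
  then have "adjugate_n n B i j = (- 1) ^ (j + i) *
      det_n (n - 1) (\<lambda>k l. B (if k < j then k else Suc k) (if l < i then l else Suc l))" for B
    using assms by (simp add: adjugate_n_def adj_mat_def cofactor_def det_n_jnf)
  then show ?thesis
    unfolding det_n_def by (auto intro!: continuous_intros assms)
qed

section \<open>Compressed slices of a decomposition\<close>

text \<open>Only the first two modes are contracted; the third compression and \<open>U\<close>
  enter as the weights of \<open>weighted\<close>.\<close>

definition modal_slice :: "nat \<Rightarrow> nat \<Rightarrow> (nat \<Rightarrow> nat \<Rightarrow> complex) \<Rightarrow> (nat \<Rightarrow> nat \<Rightarrow> complex)
    \<Rightarrow> tensor \<Rightarrow> nat \<Rightarrow> nat \<Rightarrow> nat \<Rightarrow> complex"
  where "modal_slice I1 I2 p q T k = (\<lambda>\<alpha> \<beta>. \<Sum>i<I1. \<Sum>j<I2. p \<alpha> i * q \<beta> j * T i j k)"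

definition weighted :: "nat \<Rightarrow> (nat \<Rightarrow> complex) \<Rightarrow> (nat \<Rightarrow> nat \<Rightarrow> nat \<Rightarrow> complex) \<Rightarrow> nat \<Rightarrow> nat \<Rightarrow> complex"
  where "weighted n w X = (\<lambda>\<alpha> \<beta>. \<Sum>k<n. w k * X k \<alpha> \<beta>)"

text \<open>The first mode stays uncompressed; together with \<open>modal_right\<close> this retains
  what the compression loses.\<close>

definition modal_left :: "nat \<Rightarrow> (nat \<Rightarrow> nat \<Rightarrow> complex) \<Rightarrow> tensor \<Rightarrow> nat \<Rightarrow> nat \<Rightarrow> nat \<Rightarrow> complex"
  where "modal_left I2 q T k = (\<lambda>i \<beta>. \<Sum>j<I2. q \<beta> j * T i j k)"

definition modal_right :: "nat \<Rightarrow> (nat \<Rightarrow> nat \<Rightarrow> complex) \<Rightarrow> tensor \<Rightarrow> nat \<Rightarrow> nat \<Rightarrow> nat \<Rightarrow> complex"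
  where "modal_right I1 p T k = (\<lambda>\<alpha> j. \<Sum>i<I1. p \<alpha> i * T i j k)"

definition row_scale :: "(nat \<Rightarrow> complex) \<Rightarrow> (nat \<Rightarrow> nat \<Rightarrow> complex) \<Rightarrow> nat \<Rightarrow> nat \<Rightarrow> complex"
  where "row_scale d B = (\<lambda>l j. d l * B l j)"

definition dotn :: "nat \<Rightarrow> (nat \<Rightarrow> complex) \<Rightarrow> (nat \<Rightarrow> complex) \<Rightarrow> complex"
  where "dotn n x y = (\<Sum>i<n. x i * y i)"

lemma row_scale_mm: "row_scale d (mm n A B) = mm n (row_scale d A) B"
  by (intro ext) (simp add: row_scale_def mm_def sum_distrib_left mult.assoc)

text \<open>All slices of a sum of rank one tensors share their outer factors; only the diagonal in
  between, made of the k-th entries of the third factors, varies.\<close>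

lemma modal_slice_cpd:
  "modal_slice I1 I2 p q (cpd_sum R a b c) k =
     mm R (\<lambda>\<alpha> l. dotn I1 (p \<alpha>) (a l)) (row_scale (\<lambda>l. c l k) (\<lambda>l \<beta>. dotn I2 (q \<beta>) (b l)))"
proof (intro ext)
  fix \<alpha> \<beta>
  have "modal_slice I1 I2 p q (cpd_sum R a b c) k \<alpha> \<beta> =
      (\<Sum>i<I1. \<Sum>j<I2. \<Sum>l<R. (p \<alpha> i * a l i) * (c l k * (q \<beta> j * b l j)))"
    by (simp add: modal_slice_def cpd_sum_def sum_distrib_left algebra_simps)
  also have "\<dots> = (\<Sum>l<R. \<Sum>i<I1. \<Sum>j<I2. (p \<alpha> i * a l i) * (c l k * (q \<beta> j * b l j)))"
    by (subst (2) sum.swap, subst sum.swap, rule refl)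
  also have "\<dots> = (\<Sum>l<R. dotn I1 (p \<alpha>) (a l) * (c l k * dotn I2 (q \<beta>) (b l)))"
    by (simp add: dotn_def sum_distrib_left sum_distrib_right mult.assoc)
      (rule sum.cong[OF refl], rule sum.swap)
  finally show "modal_slice I1 I2 p q (cpd_sum R a b c) k \<alpha> \<beta> =
     mm R (\<lambda>\<alpha> l. dotn I1 (p \<alpha>) (a l)) (row_scale (\<lambda>l. c l k) (\<lambda>l \<beta>. dotn I2 (q \<beta>) (b l))) \<alpha> \<beta>"
    by (simp add: mm_def row_scale_def)
qed

lemma modal_left_cpd:
  "modal_left I2 q (cpd_sum R a b c) k =
     mm R (\<lambda>i l. a l i) (row_scale (\<lambda>l. c l k) (\<lambda>l \<beta>. dotn I2 (q \<beta>) (b l)))"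
proof (intro ext)
  fix i \<beta>
  have "modal_left I2 q (cpd_sum R a b c) k i \<beta> =
      (\<Sum>j<I2. \<Sum>l<R. a l i * (c l k * (q \<beta> j * b l j)))"
    by (simp add: modal_left_def cpd_sum_def sum_distrib_left algebra_simps)
  also have "\<dots> = (\<Sum>l<R. \<Sum>j<I2. a l i * (c l k * (q \<beta> j * b l j)))"
    by (rule sum.swap)
  finally show "modal_left I2 q (cpd_sum R a b c) k i \<beta> =
     mm R (\<lambda>i l. a l i) (row_scale (\<lambda>l. c l k) (\<lambda>l \<beta>. dotn I2 (q \<beta>) (b l))) i \<beta>"
    by (simp add: mm_def row_scale_def dotn_def sum_distrib_left)
qed

lemma modal_right_cpd:
  "modal_right I1 p (cpd_sum R a b c) k =
     mm R (\<lambda>\<alpha> l. dotn I1 (p \<alpha>) (a l)) (row_scale (\<lambda>l. c l k) b)"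
proof (intro ext)
  fix \<alpha> j
  have "modal_right I1 p (cpd_sum R a b c) k \<alpha> j =
      (\<Sum>i<I1. \<Sum>l<R. (p \<alpha> i * a l i) * (c l k * b l j))"
    by (simp add: modal_right_def cpd_sum_def sum_distrib_left algebra_simps)
  also have "\<dots> = (\<Sum>l<R. \<Sum>i<I1. (p \<alpha> i * a l i) * (c l k * b l j))"
    by (rule sum.swap)
  finally show "modal_right I1 p (cpd_sum R a b c) k \<alpha> j =
     mm R (\<lambda>\<alpha> l. dotn I1 (p \<alpha>) (a l)) (row_scale (\<lambda>l. c l k) b) \<alpha> j"
    by (simp add: mm_def row_scale_def dotn_def sum_distrib_right)
qed

lemma weighted_row_scale:
  "weighted n w (\<lambda>k. mm R A (row_scale (\<lambda>l. c l k) B)) =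
     mm R A (row_scale (\<lambda>l. dotn n w (c l)) B)"
proof (intro ext)
  fix \<alpha> \<beta>
  have "weighted n w (\<lambda>k. mm R A (row_scale (\<lambda>l. c l k) B)) \<alpha> \<beta> =
      (\<Sum>k<n. \<Sum>l<R. A \<alpha> l * (w k * c l k * B l \<beta>))"
    by (simp add: weighted_def mm_def row_scale_def sum_distrib_left algebra_simps)
  also have "\<dots> = (\<Sum>l<R. \<Sum>k<n. A \<alpha> l * (w k * c l k * B l \<beta>))" by (rule sum.swap)
  finally show "weighted n w (\<lambda>k. mm R A (row_scale (\<lambda>l. c l k) B)) \<alpha> \<beta> =
     mm R A (row_scale (\<lambda>l. dotn n w (c l)) B) \<alpha> \<beta>"
    by (simp add: mm_def row_scale_def dotn_def sum_distrib_left sum_distrib_right)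
qed

text \<open>With D = diag d, the identity H (A D B) = I regrouped as (H A) (D B) = I makes H A a
  two-sided inverse of D B, so D (B H A) = I. In particular no \<open>d l\<close> vanishes.\<close>

lemma diag_factor_inverse:
  assumes "right_inv R H (mm R A (row_scale d B))" "l < R" "m < R"
  shows "d l * mm R B (mm R H A) l m = (if l = m then 1 else 0)"
proof -
  have "right_inv R (mm R H A) (row_scale d B)" using assms(1) by (simp add: right_inv_def mm_assoc)
  then have "right_inv R (row_scale d B) (mm R H A)" by (rule right_inv_sym)
  then have "row_scale d (mm R B (mm R H A)) l m = (if l = m then 1 else 0)"
    using assms by (simp add: right_inv_def row_scale_mm)
  then show ?thesis by (simp add: row_scale_def)
qed

lemma diag_factor_inverse_mm:
  assumes "right_inv R H (mm R A (row_scale d B))" "l < R"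
  shows "mm R B (mm R H (mm R A C)) l j = C l j / d l"
proof -
  note N = diag_factor_inverse[OF assms(1)]
  have d: "d l \<noteq> 0" using N[OF assms(2,2)] by auto
  have "mm R B (mm R H (mm R A C)) l j = mm R (mm R B (mm R H A)) C l j" by (simp add: mm_assoc)
  also have "\<dots> = (\<Sum>m<R. (if m = l then C m j / d l else 0))"
    unfolding mm_def[of R "mm R B (mm R H A)"]
  proof (intro sum.cong refl)
    fix m assume "m \<in> {..<R}"
    then have "d l * mm R B (mm R H A) l m = (if l = m then 1 else 0)" using N assms(2) by simp
    then have "mm R B (mm R H A) l m = (if l = m then 1 else 0) / d l"
      using d by (simp add: field_simps)
    then show "mm R B (mm R H A) l m * C m j = (if m = l then C m j / d l else 0)" by auto
  qed
  finally show ?thesis using assms(2) by simp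
qed

lemma diag_factor_inverse_row_scale:
  assumes "right_inv R H (mm R A (row_scale d B))" "l < R"
  shows "mm R (row_scale e B) (mm R H (mm R A C)) l j = e l * C l j / d l"
  unfolding row_scale_mm[symmetric]
  by (subst row_scale_def) (simp add: diag_factor_inverse_mm[OF assms])

text \<open>With X_k = A C_k B and B H A = D^-1, the product X_j H X_k equals A C_j D^-1 C_k B, and
  diagonal matrices commute.\<close>

lemma cpd_slices_commute:
  assumes T: "T = cpd_sum R a b c"
    and H: "right_inv R H (weighted I3 w (modal_slice I1 I2 p q T))"
  shows "mm R (modal_slice I1 I2 p q T j) (mm R H (modal_slice I1 I2 p q T k)) =
         mm R (modal_slice I1 I2 p q T k) (mm R H (modal_slice I1 I2 p q T j))"
proof -
  define A where "A = (\<lambda>\<alpha> l. dotn I1 (p \<alpha>) (a l))"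
  define B where "B = (\<lambda>l \<beta>. dotn I2 (q \<beta>) (b l))"
  define d where "d = (\<lambda>l. dotn I3 w (c l))"
  have X: "modal_slice I1 I2 p q T k = mm R A (row_scale (\<lambda>l. c l k) B)" for k
    by (simp add: T modal_slice_cpd A_def B_def)
  have H': "right_inv R H (mm R A (row_scale d B))"
    using H unfolding X weighted_row_scale d_def .
  note inner = diag_factor_inverse_row_scale[OF H']
  have *: "mm R (mm R A (row_scale c1 B)) (mm R H (mm R A (row_scale c2 B))) =
      mm R A (\<lambda>l j. c1 l * c2 l * B l j / d l)" for c1 c2
    unfolding mm_assoc
    by (intro ext mm_cong refl) (simp add: inner, simp add: row_scale_def)
  show ?thesis unfolding X * by (simp add: mult.commute)
qed

text \<open>The outer factors are a D B and A D b, the middle one is A C_k B. Both occurrences of B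
  H A contribute D^-1, which cancels the two D and leaves a C_k b, the k-th slice of
  \<open>T\<close>.\<close>

lemma cpd_reconstruct:
  assumes T: "T = cpd_sum R a b c"
    and H: "right_inv R H (weighted I3 w (modal_slice I1 I2 p q T))"
  shows "T i j k = mm R (weighted I3 w (modal_left I2 q T)) (mm R H (mm R (modal_slice I1 I2 p q T k)
           (mm R H (weighted I3 w (modal_right I1 p T))))) i j"
proof -
  define A where "A = (\<lambda>\<alpha> l. dotn I1 (p \<alpha>) (a l))"
  define B where "B = (\<lambda>l \<beta>. dotn I2 (q \<beta>) (b l))"
  define d where "d = (\<lambda>l. dotn I3 w (c l))"
  have X: "modal_slice I1 I2 p q T k = mm R A (row_scale (\<lambda>l. c l k) B)" for k
    by (simp add: T modal_slice_cpd A_def B_def)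
  have P: "weighted I3 w (modal_left I2 q T) = mm R (\<lambda>i l. a l i) (row_scale d B)"
    unfolding T d_def weighted_row_scale[symmetric] B_def modal_left_cpd[symmetric] by (rule refl)
  have Q: "weighted I3 w (modal_right I1 p T) = mm R A (row_scale d b)"
    unfolding T d_def weighted_row_scale[symmetric] A_def modal_right_cpd[symmetric] by (rule refl)
  have H': "right_inv R H (mm R A (row_scale d B))"
    using H unfolding X weighted_row_scale d_def .
  have d: "d l \<noteq> 0" if "l < R" for l
    using diag_factor_inverse[OF H' that that] by auto
  note inner = diag_factor_inverse_row_scale[OF H']
  have "mm R (\<lambda>i l. a l i) (mm R (row_scale d B) (mm R H (mm R A
          (mm R (row_scale (\<lambda>l. c l k) B) (mm R H (mm R A (row_scale d b))))))) i j =
        mm R (\<lambda>i l. a l i) (\<lambda>l j. c l k * b l j) i j"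
    using d by (intro mm_cong refl) (simp add: inner, simp add: row_scale_def)
  also have "\<dots> = T i j k" by (simp add: T cpd_sum_def mm_def algebra_simps)
  finally show ?thesis unfolding P Q X mm_assoc by simp
qed

section \<open>Linear algebra over the real or complex numbers\<close>

lemma Kfield_closed [simp, intro]:
  "0 \<in> Kfield F" "1 \<in> Kfield F"
  "x \<in> Kfield F \<Longrightarrow> y \<in> Kfield F \<Longrightarrow> x + y \<in> Kfield F"
  "x \<in> Kfield F \<Longrightarrow> y \<in> Kfield F \<Longrightarrow> x - y \<in> Kfield F"
  "x \<in> Kfield F \<Longrightarrow> y \<in> Kfield F \<Longrightarrow> x * y \<in> Kfield F"
  "x \<in> Kfield F \<Longrightarrow> y \<in> Kfield F \<Longrightarrow> x / y \<in> Kfield F"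
  "x \<in> Kfield F \<Longrightarrow> - x \<in> Kfield F"
  "x \<in> Kfield F \<Longrightarrow> cnj x \<in> Kfield F"
  by (auto simp: Kfield_def)

lemma Kfield_sum [simp, intro]: "(\<And>i. i \<in> A \<Longrightarrow> f i \<in> Kfield F) \<Longrightarrow> sum f A \<in> Kfield F"
  by (induction A rule: infinite_finite_induct) auto

text \<open>For real \<open>A\<close> the entrywise real part of \<open>B\<close> is again a right
  inverse, so uniqueness forces \<open>B\<close> to be real.\<close>

lemma right_inv_Kfield:
  assumes A: "\<And>i j. i < n \<Longrightarrow> j < n \<Longrightarrow> A i j \<in> Kfield F"
    and B: "right_inv n A B" and ij: "i < n" "j < n"
  shows "B i j \<in> Kfield F"
proof (cases F)
  case True
  define B' where "B' = (\<lambda>i j. complex_of_real (Re (B i j)))"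
  have "mm n A B' i j = (if i = j then 1 else 0)" if "i < n" "j < n" for i j
  proof -
    have "mm n A B' i j = complex_of_real (Re (mm n A B i j))"
      unfolding mm_def B'_def Re_sum of_real_sum
    proof (intro sum.cong refl)
      fix l assume "l \<in> {..<n}"
      then have "A i l \<in> \<real>" using A[of i l] that True by (auto simp: Kfield_def)
      then show "A i l * complex_of_real (Re (B l j)) = complex_of_real (Re (A i l * B l j))"
        by (auto simp: complex_is_Real_iff complex_eq_iff)
    qed
    then show ?thesis using B that by (auto simp: right_inv_def)
  qed
  then have "right_inv n A B'" by (auto simp: right_inv_def)
  then have "B i j = B' i j" using right_inv_unique[OF right_inv_sym[OF B]] ij by blast
  then have "B i j \<in> \<real>" unfolding B'_def by (metis Reals_of_real)
  then show ?thesis using True by (simp add: Kfield_def)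
qed (simp add: Kfield_def)

text \<open>Real and imaginary parts of a complex kernel vector of a real matrix lie in the kernel,
  and one of them is nonzero.\<close>

lemma det_n_zero_kernel_Kfield:
  assumes det: "det_n n A = 0" and A: "\<And>i j. i < n \<Longrightarrow> j < n \<Longrightarrow> A i j \<in> Kfield F"
  obtains v where "\<And>i. v i \<in> Kfield F" "\<exists>i<n. v i \<noteq> 0"
    "\<And>i. i < n \<Longrightarrow> (\<Sum>j<n. A i j * v j) = 0"
proof -
  obtain v where v: "\<exists>i<n. v i \<noteq> 0" "\<And>i. i < n \<Longrightarrow> (\<Sum>j<n. A i j * v j) = 0"
    using det_n_zero_kernel[OF det] by blast
  show ?thesis
  proof (cases F)
    case True
    have real: "A i j \<in> \<real>" if "i < n" "j < n" for i j
      using A that True by (auto simp: Kfield_def)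
    have re: "(\<Sum>j<n. A i j * complex_of_real (Re (v j))) = 0" if "i < n" for i
    proof -
      have "(\<Sum>j<n. A i j * complex_of_real (Re (v j))) = complex_of_real (Re (\<Sum>j<n. A i j * v j))"
        unfolding Re_sum of_real_sum using real that
        by (intro sum.cong refl) (auto simp: complex_is_Real_iff complex_eq_iff)
      then show ?thesis using v(2) that by simp
    qed
    have im: "(\<Sum>j<n. A i j * complex_of_real (Im (v j))) = 0" if "i < n" for i
    proof -
      have "(\<Sum>j<n. A i j * complex_of_real (Im (v j))) = complex_of_real (Im (\<Sum>j<n. A i j * v j))"
        unfolding Im_sum of_real_sum using real that
        by (intro sum.cong refl) (auto simp: complex_is_Real_iff complex_eq_iff)
      then show ?thesis using v(2) that by simp
    qed
    obtain i where "i < n" "Re (v i) \<noteq> 0 \<or> Im (v i) \<noteq> 0"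
      using v(1) by (auto simp: complex_eq_iff)
    then show ?thesis
      using that[of "\<lambda>i. complex_of_real (Re (v i))"] that[of "\<lambda>i. complex_of_real (Im (v i))"] re im True
      by (auto simp: Kfield_def)
  qed (use v that in \<open>auto simp: Kfield_def\<close>)
qed

section \<open>Distinct eigenvalues and simultaneous diagonalization\<close>

text \<open>A vanishing combination is hit with the factors Z - \<tau>_m for all m other than
  \<open>r0\<close>, one at a time. Every term but that of \<open>r0\<close> dies, and its
  coefficient survives because the eigenvalues are distinct.\<close>

lemma eigenvectors_independent:
  fixes Z :: "nat \<Rightarrow> nat \<Rightarrow> complex"
  assumes eig: "\<And>r i. r < n \<Longrightarrow> i < n \<Longrightarrow> (\<Sum>j<n. Z i j * u r j) = \<tau> r * u r i"
    and inj: "inj_on \<tau> {..<n}" and nz: "\<And>r. r < n \<Longrightarrow> \<exists>i<n. u r i \<noteq> 0"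
  shows "det_n n (\<lambda>i r. u r i) \<noteq> 0"
proof
  assume "det_n n (\<lambda>i r. u r i) = 0"
  then obtain x where x: "\<exists>r<n. x r \<noteq> 0" "\<And>i. i < n \<Longrightarrow> (\<Sum>r<n. u r i * x r) = 0"
    using det_n_zero_kernel by blast
  then obtain r0 where r0: "r0 < n" "x r0 \<noteq> 0" by blast
  have *: "(\<Sum>r<n. u r i * x r * (\<Prod>m\<in>S. \<tau> r - \<tau> m)) = 0" if "finite S" "i < n" for S i
    using that
  proof (induction S arbitrary: i rule: finite_induct)
    case (insert s S)
    have "(\<Sum>r<n. u r i * x r * (\<tau> r * (\<Prod>m\<in>S. \<tau> r - \<tau> m))) =
        (\<Sum>r<n. (\<Sum>j<n. Z i j * u r j) * x r * (\<Prod>m\<in>S. \<tau> r - \<tau> m))"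
      using eig insert.prems by (intro sum.cong refl) (simp add: algebra_simps)
    also have "\<dots> = (\<Sum>r<n. \<Sum>j<n. Z i j * (u r j * x r * (\<Prod>m\<in>S. \<tau> r - \<tau> m)))"
      by (simp add: sum_distrib_right mult.assoc)
    also have "\<dots> = (\<Sum>j<n. Z i j * (\<Sum>r<n. u r j * x r * (\<Prod>m\<in>S. \<tau> r - \<tau> m)))"
      by (subst sum.swap) (simp add: sum_distrib_left)
    also have "\<dots> = 0" using insert.IH by simp
    finally have "(\<Sum>r<n. u r i * x r * (\<tau> r * (\<Prod>m\<in>S. \<tau> r - \<tau> m))) = 0" .
    moreover have "(\<Sum>r<n. u r i * x r * (\<tau> s * (\<Prod>m\<in>S. \<tau> r - \<tau> m))) =
        \<tau> s * (\<Sum>r<n. u r i * x r * (\<Prod>m\<in>S. \<tau> r - \<tau> m))"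
      by (simp add: sum_distrib_left algebra_simps)
    ultimately have "(\<Sum>r<n. u r i * x r * (\<tau> r * (\<Prod>m\<in>S. \<tau> r - \<tau> m))) -
        (\<Sum>r<n. u r i * x r * (\<tau> s * (\<Prod>m\<in>S. \<tau> r - \<tau> m))) = 0"
      using insert.IH insert.prems by simp
    then show ?case
      using insert.hyps by (simp add: sum_subtractf[symmetric] algebra_simps)
  qed (use x in simp)
  define S where "S = {..<n} - {r0}"
  obtain i where i: "i < n" "u r0 i \<noteq> 0" using nz r0 by blast
  have "(\<Sum>r<n. u r i * x r * (\<Prod>m\<in>S. \<tau> r - \<tau> m)) =
      u r0 i * x r0 * (\<Prod>m\<in>S. \<tau> r0 - \<tau> m)"
  proof (subst sum.remove[of _ r0])
    have "(\<Prod>m\<in>S. \<tau> r - \<tau> m) = 0" if "r \<in> {..<n} - {r0}" for r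
      using that by (auto simp: S_def)
    then show "u r0 i * x r0 * (\<Prod>m\<in>S. \<tau> r0 - \<tau> m) +
        (\<Sum>r\<in>{..<n} - {r0}. u r i * x r * (\<Prod>m\<in>S. \<tau> r - \<tau> m)) =
        u r0 i * x r0 * (\<Prod>m\<in>S. \<tau> r0 - \<tau> m)" by simp
  qed (use r0 in auto)
  moreover have "(\<Prod>m\<in>S. \<tau> r0 - \<tau> m) \<noteq> 0"
    using inj r0 by (auto simp: S_def inj_on_def)
  ultimately show False using *[of S i] i r0 by (auto simp: S_def)
qed

text \<open>In the eigenbasis \<open>Z\<close> becomes diag \<tau> and commutes with E' Y E;
  evaluating E' Z Y E in both orders shows that the (m, r) entry is killed by \<tau>_m -
  \<tau>_r.\<close>

lemma commuting_diagonal: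
  assumes eig: "\<And>r i. r < n \<Longrightarrow> i < n \<Longrightarrow> mm n Z E i r = \<tau> r * E i r"
    and inj: "inj_on \<tau> {..<n}"
    and E: "right_inv n E' E"
    and comm: "\<And>i j. i < n \<Longrightarrow> j < n \<Longrightarrow> mm n Z Y i j = mm n Y Z i j"
    and rm: "r < n" "m < n" "r \<noteq> m"
  shows "mm n E' (mm n Y E) m r = 0"
proof -
  note E2 = right_inv_sym[OF E]
  have ZE: "mm n Z E i r = mm n E (\<lambda>l r. if l = r then \<tau> r else 0) i r" if "i < n" "r < n" for i r
    using eig[OF that(2,1)] that by (simp add: mm_def if_distrib cong: if_cong)
  have "mm n E' (mm n Z (mm n Y E)) m r = mm n E' (mm n (mm n Z Y) E) m r" by (simp add: mm_assoc)
  also have "\<dots> = mm n E' (mm n (mm n Y Z) E) m r"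
    by (rule mm_cong, rule refl, rule mm_cong, use comm in auto)
  also have "\<dots> = mm n (mm n E' Y) (mm n Z E) m r" by (simp add: mm_assoc)
  also have "\<dots> = mm n (mm n E' Y) (\<lambda>i r. \<tau> r * E i r) m r"
    using eig rm by (intro mm_cong) auto
  also have "\<dots> = \<tau> r * mm n E' (mm n Y E) m r"
    unfolding mm_assoc[symmetric] by (simp add: mm_def[of n "mm n E' Y"] sum_distrib_left algebra_simps)
  finally have 1: "mm n E' (mm n Z (mm n Y E)) m r = \<tau> r * mm n E' (mm n Y E) m r" .
  define W where "W = mm n Y E"
  have "mm n E' (mm n Z W) m r = mm n E' (mm n Z (mm n E (mm n E' W))) m r"
    using right_inv_mult[OF E2] rm by (intro mm_cong refl) simp
  also have "\<dots> = mm n E' (mm n (mm n Z E) (mm n E' W)) m r" by (simp add: mm_assoc)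
  also have "\<dots> = mm n E' (mm n (mm n E (\<lambda>l r. if l = r then \<tau> r else 0)) (mm n E' W)) m r"
    by (rule mm_cong, rule refl, rule mm_cong, use ZE in auto)
  also have "\<dots> = mm n E' (mm n E (mm n (\<lambda>l r. if l = r then \<tau> r else 0) (mm n E' W))) m r"
    by (simp add: mm_assoc)
  also have "\<dots> = mm n (\<lambda>l r. if l = r then \<tau> r else 0) (mm n E' W) m r"
    using right_inv_mult[OF E] rm by simp
  also have "\<dots> = \<tau> m * mm n E' W m r"
    using rm by (simp add: mm_def[of n "\<lambda>l r. if l = r then \<tau> r else 0"] if_distrib[where f="\<lambda>x. x * _"] cong: if_cong)
  finally have "\<tau> m * mm n E' W m r = \<tau> r * mm n E' W m r" using 1 by (auto simp: W_def)
  moreover have "\<tau> m \<noteq> \<tau> r" using inj rm by (auto simp: inj_on_def)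
  ultimately show ?thesis by (simp add: W_def)
qed

section \<open>Simple pencils\<close>

text \<open>Non-proportionality of two binary forms becomes a nonzero 2x2 determinant. This uses
  that the forms are nonzero: their product at \<open>g\<close> is the determinant of an invertible
  matrix.\<close>

lemma simple_pencil_forms:
  assumes "simple_tensor (Kfield F) R 2 (pencil P Q)"
  obtains g0 g1 lf where "g0 \<in> Kfield F" "g1 \<in> Kfield F"
    "\<forall>r<R. \<forall>k. lf r k \<in> Kfield F"
    "\<forall>r<R. \<forall>s<R. r \<noteq> s \<longrightarrow> lf r 0 * lf s 1 \<noteq> lf r 1 * lf s (0::nat)"
    "\<forall>x\<in>Kfield F. \<forall>y\<in>Kfield F.
       det_n R (\<lambda>\<alpha> \<beta>. x * P \<alpha> \<beta> + y * Q \<alpha> \<beta>) = (\<Prod>r<R. lf r 0 * x + lf r 1 * y)"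
    "det_n R (\<lambda>\<alpha> \<beta>. g0 * P \<alpha> \<beta> + g1 * Q \<alpha> \<beta>) \<noteq> 0"
proof -
  let ?F = "Kfield F"
  obtain g lf where g: "vec_in ?F 2 g" "invertible_n R (slice_comb 2 g (pencil P Q))"
    and lf: "\<And>r. r < R \<Longrightarrow> vec_in ?F 2 (lf r)"
    and np: "\<And>r s. r < R \<Longrightarrow> s < R \<Longrightarrow> r \<noteq> s \<Longrightarrow> \<not> (\<exists>c\<in>?F. lf r = (\<lambda>k. c * lf s k))"
    and dt: "\<And>g. vec_in ?F 2 g \<Longrightarrow>
      det_n R (slice_comb 2 g (pencil P Q)) = (\<Prod>r<R. \<Sum>k<2. lf r k * g k)"
    using assms unfolding simple_tensor_def by blast
  have comb: "slice_comb 2 g (pencil P Q) = (\<lambda>\<alpha> \<beta>. g 0 * P \<alpha> \<beta> + g 1 * Q \<alpha> \<beta>)" for g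
    by (intro ext) (simp add: slice_comb_def pencil_def numeral_2_eq_2)
  have det: "det_n R (\<lambda>\<alpha> \<beta>. x * P \<alpha> \<beta> + y * Q \<alpha> \<beta>) = (\<Prod>r<R. lf r 0 * x + lf r 1 * y)"
    if "x \<in> ?F" "y \<in> ?F" for x y
  proof -
    have "vec_in ?F 2 (\<lambda>k. if k = 0 then x else if k = 1 then y else 0)"
      using that by (auto simp: vec_in_def)
    from dt[OF this] show ?thesis unfolding comb by (simp add: numeral_2_eq_2)
  qed
  have lfF: "lf r k \<in> ?F" if "r < R" for r k
    using lf[OF that] by (auto simp: vec_in_def split: if_splits)
  have lf0: "lf r k = 0" if "r < R" "k \<ge> 2" for r k
    using lf[OF that(1)] that(2) by (auto simp: vec_in_def)
  have gF: "g 0 \<in> ?F" "g 1 \<in> ?F" using g(1) by (auto simp: vec_in_def)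
  obtain B where "right_inv R (slice_comb 2 g (pencil P Q)) B"
    using g(2) unfolding invertible_n_def right_inv_def mm_def by blast
  then have nz: "det_n R (\<lambda>\<alpha> \<beta>. g 0 * P \<alpha> \<beta> + g 1 * Q \<alpha> \<beta>) \<noteq> 0"
    using right_inv_det unfolding comb by fastforce
  then have lfg: "lf r 0 * g 0 + lf r 1 * g 1 \<noteq> 0" if "r < R" for r
    using that det[OF gF] by auto
  have cross: "lf r 0 * lf s 1 \<noteq> lf r 1 * lf s 0" if rs: "r < R" "s < R" "r \<noteq> s" for r s
  proof
    assume eq: "lf r 0 * lf s 1 = lf r 1 * lf s 0"
    have "lf s 0 \<noteq> 0 \<or> lf s 1 \<noteq> 0" using lfg[OF rs(2)] by auto
    then have "\<exists>k<2. lf s k \<noteq> 0"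
      by (elim disjE) (rule exI[of _ 0], simp, rule exI[of _ 1], simp)
    then obtain k where k: "k < 2" "lf s k \<noteq> 0" by blast
    have "lf r m = lf r k / lf s k * lf s m" for m
    proof (cases "m < 2")
      case True
      then show ?thesis using k eq by (auto simp: less_2_cases_iff field_simps)
    qed (simp add: lf0 rs)
    then have "lf r = (\<lambda>m. lf r k / lf s k * lf s m)" by (rule ext)
    moreover have "lf r k / lf s k \<in> ?F" using lfF rs by simp
    ultimately show False using np[OF rs] by blast
  qed
  show ?thesis by (rule that[OF gF _ _ _ nz, of lf]) (use lfF cross det in simp_all)
qed

text \<open>At the point (lf r 1, - lf r 0) the r-th form vanishes, so this combination of
  \<open>P\<close> and \<open>Q\<close> is singular; a kernel vector is a generalized eigenvector of
  the pencil, over K because the point and the matrices are.\<close>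

lemma simple_pencil_eigenvectors:
  assumes simple: "simple_tensor (Kfield F) R 2 (pencil P Q)"
    and PQ: "\<And>i j. i < R \<Longrightarrow> j < R \<Longrightarrow> P i j \<in> Kfield F" "\<And>i j. i < R \<Longrightarrow> j < R \<Longrightarrow> Q i j \<in> Kfield F"
  obtains g0 g1 s0 s1 u \<tau> where "g0 \<in> Kfield F" "g1 \<in> Kfield F"
    "det_n R (\<lambda>\<alpha> \<beta>. g0 * P \<alpha> \<beta> + g1 * Q \<alpha> \<beta>) \<noteq> 0"
    "inj_on \<tau> {..<R}" "\<forall>r<R. \<forall>i. u r i \<in> Kfield F" "\<forall>r<R. \<exists>i<R. u r i \<noteq> 0"
    "\<forall>r<R. \<forall>i<R. (\<Sum>j<R. (s0 * P i j + s1 * Q i j) * u r j) =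
        \<tau> r * (\<Sum>j<R. (g0 * P i j + g1 * Q i j) * u r j)"
proof -
  let ?F = "Kfield F"
  obtain g0 g1 lf where g: "g0 \<in> ?F" "g1 \<in> ?F"
    and lf: "\<forall>r<R. \<forall>k. lf r k \<in> ?F"
    and np: "\<forall>r<R. \<forall>s<R. r \<noteq> s \<longrightarrow> lf r 0 * lf s 1 \<noteq> lf r 1 * lf s (0::nat)"
    and det: "\<forall>x\<in>?F. \<forall>y\<in>?F.
       det_n R (\<lambda>\<alpha> \<beta>. x * P \<alpha> \<beta> + y * Q \<alpha> \<beta>) = (\<Prod>r<R. lf r 0 * x + lf r 1 * y)"
    and nz: "det_n R (\<lambda>\<alpha> \<beta>. g0 * P \<alpha> \<beta> + g1 * Q \<alpha> \<beta>) \<noteq> 0"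
    by (rule simple_pencil_forms[OF simple])
  note lf = lf[rule_format] and np = np[rule_format] and det = det[rule_format]
  define ev where "ev r = lf r 0 * g0 + lf r 1 * g1" for r
  have lg: "ev r \<noteq> 0" if "r < R" for r
    using that nz det[OF g] by (auto simp: ev_def)
  define ker_vec where "ker_vec r v \<longleftrightarrow> (\<forall>i. v i \<in> ?F) \<and> (\<exists>i<R. v i \<noteq> 0) \<and>
      (\<forall>i<R. (\<Sum>j<R. (lf r 1 * P i j + - lf r 0 * Q i j) * v j) = 0)" for r v
  have ex: "\<exists>v. ker_vec r v" if r: "r < R" for r
  proof -
    have "det_n R (\<lambda>i j. lf r 1 * P i j + - lf r 0 * Q i j) = 0"
      using r lf by (subst det) (auto intro!: bexI[of _ r])
    then obtain v where "\<And>i. v i \<in> ?F" "\<exists>i<R. v i \<noteq> 0"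
      "\<And>i. i < R \<Longrightarrow> (\<Sum>j<R. (lf r 1 * P i j + - lf r 0 * Q i j) * v j) = 0"
      by (rule det_n_zero_kernel_Kfield[of _ _ F]) (use lf[OF r] PQ in auto)
    then show ?thesis unfolding ker_vec_def by blast
  qed
  define u where "u r = (SOME v. ker_vec r v)" for r
  have "ker_vec r (u r)" if "r < R" for r
    unfolding u_def by (rule someI_ex[OF ex[OF that]])
  then have u: "\<And>r i. r < R \<Longrightarrow> u r i \<in> ?F" "\<And>r. r < R \<Longrightarrow> \<exists>i<R. u r i \<noteq> 0"
    and ker: "\<And>r i. r < R \<Longrightarrow> i < R \<Longrightarrow> (\<Sum>j<R. (lf r 1 * P i j + - lf r 0 * Q i j) * u r j) = 0"
    unfolding ker_vec_def by simp_all
  define Pu Qu where "Pu r i = (\<Sum>j<R. P i j * u r j)" and "Qu r i = (\<Sum>j<R. Q i j * u r j)" for r i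
  have lin: "(\<Sum>j<R. (x * P i j + y * Q i j) * u r j) = x * Pu r i + y * Qu r i" for x y r i
    by (simp add: Pu_def Qu_def sum_distrib_left sum.distrib[symmetric] algebra_simps)
  have ker': "lf r 1 * Pu r i = lf r 0 * Qu r i" if "r < R" "i < R" for r i
    using ker[OF that] unfolding lin by simp
  \<comment> \<open>By \<open>ker'\<close>, the pair (P u_r, Q u_r) is proportional to (lf r 0, lf r
    1). Dividing by \<open>ev r\<close>, the value of the r-th form at (g0, g1), expresses both
    through (g0 P + g1 Q) u_r.\<close>
  have P: "Pu r i = lf r 0 / ev r * (g0 * Pu r i + g1 * Qu r i)" if "r < R" "i < R" for r i
  proof -
    have "ev r * Pu r i = lf r 0 * g0 * Pu r i + g1 * (lf r 1 * Pu r i)"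
      by (simp add: ev_def algebra_simps)
    also have "\<dots> = lf r 0 * (g0 * Pu r i + g1 * Qu r i)"
      unfolding ker'[OF that] by (simp add: algebra_simps)
    finally show ?thesis using lg[OF that(1)] by (simp add: nonzero_eq_divide_eq mult.commute)
  qed
  have Q: "Qu r i = lf r 1 / ev r * (g0 * Pu r i + g1 * Qu r i)" if "r < R" "i < R" for r i
  proof -
    have "ev r * Qu r i = g0 * (lf r 0 * Qu r i) + lf r 1 * g1 * Qu r i"
      by (simp add: ev_def algebra_simps)
    also have "\<dots> = lf r 1 * (g0 * Pu r i + g1 * Qu r i)"
      unfolding ker'[OF that, symmetric] by (simp add: algebra_simps)
    finally show ?thesis using lg[OF that(1)] by (simp add: nonzero_eq_divide_eq mult.commute)
  qed
  \<comment> \<open>The eigenvalues must be distinct. Equal ratios lf r 1 / ev r force g0 times a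
    nonzero 2x2 determinant to vanish, so \<open>Q\<close> serves when g0 is nonzero; otherwise
    \<open>P\<close> serves, with g1 in the role of g0.\<close>
  show ?thesis
  proof (cases "g0 = 0")
    case True
    have "inj_on (\<lambda>r. lf r 0 / ev r) {..<R}"
    proof (rule inj_onI, rule ccontr)
      fix r s assume rs: "r \<in> {..<R}" "s \<in> {..<R}" "lf r 0 / ev r = lf s 0 / ev s" "r \<noteq> s"
      then have "g1 * (lf r 0 * lf s 1 - lf r 1 * lf s 0) = 0"
        using lg[of r] lg[of s] True by (auto simp: ev_def field_simps)
      then show False using np[of r s] rs lg[of r] True by (auto simp: ev_def)
    qed
    then show ?thesis
      using that[of g0 g1 "\<lambda>r. lf r 0 / ev r" u 1 0] g nz u P unfolding lin by simp
  next
    case False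
    have "inj_on (\<lambda>r. lf r 1 / ev r) {..<R}"
    proof (rule inj_onI, rule ccontr)
      fix r s assume rs: "r \<in> {..<R}" "s \<in> {..<R}" "lf r 1 / ev r = lf s 1 / ev s" "r \<noteq> s"
      then have "lf r 1 * ev s = lf s 1 * ev r"
        using lg[of r] lg[of s] by (auto simp: field_simps)
      then have "g0 * (lf r 0 * lf s 1 - lf r 1 * lf s 0) = 0"
        by (auto simp: ev_def algebra_simps)
      then show False using np[of r s] rs False by auto
    qed
    then show ?thesis
      using that[of g0 g1 "\<lambda>r. lf r 1 / ev r" u 0 1] g nz u Q unfolding lin by simp
  qed
qed

section \<open>From commuting slices to a decomposition over K\<close>

lemma mm_weighted_left: "mm R (weighted n w X) B = weighted n w (\<lambda>k. mm R (X k) B)"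
  by (intro ext) (simp add: mm_def weighted_def sum_distrib_left sum_distrib_right mult.assoc, rule sum.swap)

lemma mm_weighted_right: "mm R A (weighted n w X) = weighted n w (\<lambda>k. mm R A (X k))"
  by (intro ext) (simp add: mm_def weighted_def sum_distrib_left mult.left_commute, rule sum.swap)

text \<open>Inserting E E' = I twice turns the reconstruction L H X_k H N into (L E) (E' H X_k E)
  (E' H N), where \<open>E\<close> holds the eigenvectors of H S. Each H X_k commutes with H S, so
  the middle factor is diagonal for every k; columns of L E, rows of E' H N and these diagonals are
  the three factors. The assumptions range over all \<open>w\<close> and \<open>H\<close> because
  the invertible combination is found only inside the proof.\<close>

lemma decomposition_of_commuting_slices:
  assumes T: "tensor_in (Kfield F) I1 I2 I3 T"
    and pq: "\<And>\<alpha> i. \<alpha> < R \<Longrightarrow> p \<alpha> i \<in> Kfield F" "\<And>\<beta> j. \<beta> < R \<Longrightarrow> q \<beta> j \<in> Kfield F"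
    and h: "\<And>k. h0 k \<in> Kfield F" "\<And>k. h1 k \<in> Kfield F"
    and X: "X = modal_slice I1 I2 p q T"
    and simple: "simple_tensor (Kfield F) R 2 (pencil (weighted I3 h0 X) (weighted I3 h1 X))"
    and comm: "\<And>w H j k. right_inv R H (weighted I3 w X) \<Longrightarrow>
      mm R (X j) (mm R H (X k)) = mm R (X k) (mm R H (X j))"
    and reconstruct: "\<And>w H i j k. right_inv R H (weighted I3 w X) \<Longrightarrow>
      T i j k = mm R (weighted I3 w (modal_left I2 q T)) (mm R H (mm R (X k)
           (mm R H (weighted I3 w (modal_right I1 p T))))) i j"
  obtains a b c where "T = cpd_sum R a b c" "\<And>l. l < R \<Longrightarrow> vec_in (Kfield F) I1 (a l)"
    "\<And>l. l < R \<Longrightarrow> vec_in (Kfield F) I2 (b l)" "\<And>l. l < R \<Longrightarrow> vec_in (Kfield F) I3 (c l)"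
proof -
  let ?F = "Kfield F"
  define P Q where "P = weighted I3 h0 X" and "Q = weighted I3 h1 X"
  have TF: "T i j k \<in> ?F" for i j k
    using T unfolding tensor_in_def by (metis Kfield_closed(1))
  have XF: "X k i j \<in> ?F" if "i < R" "j < R" for k i j
    using pq that TF by (auto simp: X modal_slice_def)
  have PQF: "P i j \<in> ?F" "Q i j \<in> ?F" if "i < R" "j < R" for i j
    using XF that h by (auto simp: P_def Q_def weighted_def)
  have sPQ: "simple_tensor ?F R 2 (pencil P Q)" using simple by (simp add: P_def Q_def)
  obtain g0 g1 s0 s1 u \<tau> where g: "g0 \<in> ?F" "g1 \<in> ?F"
    and det: "det_n R (\<lambda>\<alpha> \<beta>. g0 * P \<alpha> \<beta> + g1 * Q \<alpha> \<beta>) \<noteq> 0"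
    and inj: "inj_on \<tau> {..<R}" and uF: "\<forall>r<R. \<forall>i. u r i \<in> ?F"
    and unz: "\<forall>r<R. \<exists>i<R. u r i \<noteq> 0"
    and eig: "\<forall>r<R. \<forall>i<R. (\<Sum>j<R. (s0 * P i j + s1 * Q i j) * u r j) =
        \<tau> r * (\<Sum>j<R. (g0 * P i j + g1 * Q i j) * u r j)"
    by (rule simple_pencil_eigenvectors[OF sPQ PQF])
  note uF = uF[rule_format] and unz = unz[rule_format] and eig = eig[rule_format]
  \<comment> \<open>The weights \<open>w\<close> give the invertible combination \<open>G\<close>,
    and \<open>s\<close> the combination whose eigenvalues relative to \<open>G\<close> are
    distinct.\<close>
  define w where "w = (\<lambda>k. g0 * h0 k + g1 * h1 k)"
  define s where "s = (\<lambda>k. s0 * h0 k + s1 * h1 k)"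
  have lin: "weighted I3 (\<lambda>k. x * h0 k + y * h1 k) X = (\<lambda>\<alpha> \<beta>. x * P \<alpha> \<beta> + y * Q \<alpha> \<beta>)" for x y
    by (intro ext)
      (simp add: weighted_def P_def Q_def sum_distrib_left sum.distrib[symmetric] algebra_simps)
  define G where "G = weighted I3 w X"
  define S where "S = weighted I3 s X"
  have "det_n R G \<noteq> 0" using det by (simp add: G_def w_def lin)
  then obtain H where HG: "right_inv R H G" and GH: "right_inv R G H"
    using adjugate_n_inverse by blast
  have wF: "w k \<in> ?F" for k using g h by (simp add: w_def)
  have GF: "G i j \<in> ?F" if "i < R" "j < R" for i j
    using XF that wF by (auto simp: G_def weighted_def)
  have HF: "H i j \<in> ?F" if "i < R" "j < R" for i j
    using right_inv_Kfield[OF _ GH] GF that by blast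
  define E where "E = (\<lambda>i r. u r i)"
  define Z where "Z = mm R H S"
  have SE: "mm R S E i r = \<tau> r * mm R G E i r" if "r < R" "i < R" for i r
    using eig[OF that] by (simp add: S_def G_def s_def w_def lin mm_def E_def)
  have ZE: "mm R Z E i r = \<tau> r * E i r" if "r < R" "i < R" for i r
  proof -
    have "mm R Z E i r = mm R H (mm R S E) i r" by (simp add: Z_def mm_assoc)
    also have "\<dots> = mm R H (\<lambda>i r. \<tau> r * mm R G E i r) i r"
      using SE that by (intro mm_cong refl) simp
    also have "\<dots> = \<tau> r * mm R H (mm R G E) i r"
      by (simp add: mm_def[of R H] sum_distrib_left algebra_simps)
    also have "\<dots> = \<tau> r * E i r" using right_inv_mult[OF HG that(2)] by simp
    finally show ?thesis .
  qed
  have "det_n R E \<noteq> 0"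
    unfolding E_def by (rule eigenvectors_independent[OF _ inj unz, of Z])
      (use ZE in \<open>simp_all add: mm_def E_def\<close>)
  then obtain E' where E'E: "right_inv R E' E" and EE': "right_inv R E E'"
    using adjugate_n_inverse by blast
  have E'F: "E' i j \<in> ?F" if "i < R" "j < R" for i j
    using right_inv_Kfield[OF _ EE'] uF that by (auto simp: E_def)
  \<comment> \<open>Commutation extends from single slices to \<open>S\<close> because both sides
    are linear in the slice that is being combined.\<close>
  have "mm R S (mm R H (X k)) = mm R (X k) (mm R H S)" for k
    unfolding S_def mm_weighted_left mm_weighted_right
    by (simp only: comm[OF HG[unfolded G_def], of k])
  then have ZX: "mm R Z (mm R H (X k)) = mm R (mm R H (X k)) Z" for k
    by (simp add: Z_def mm_assoc)
  define D where "D = (\<lambda>k. mm R E' (mm R (mm R H (X k)) E))"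
  have D0: "D k m r = 0" if "r < R" "m < R" "r \<noteq> m" for k m r
    unfolding D_def by (rule commuting_diagonal[OF ZE inj E'E _ that]) (simp_all add: ZX)
  define L where "L = weighted I3 w (modal_left I2 q T)"
  define N where "N = weighted I3 w (modal_right I1 p T)"
  define a where "a = (\<lambda>l i. mm R L E i l)"
  define b where "b = mm R E' (mm R H N)"
  define c where "c = (\<lambda>l k. D k l l)"
  have T_eq: "T i j k = cpd_sum R a b c i j k" for i j k
  proof -
    define V where "V = mm R H N"
    have "T i j k = mm R L (mm R H (mm R (X k) V)) i j"
      using reconstruct[OF HG[unfolded G_def], of i j k] by (simp add: L_def N_def V_def)
    also have "\<dots> = mm R L (mm R E (mm R E' (mm R H (mm R (X k) V)))) i j"
      by (rule mm_cong) (simp_all add: right_inv_mult[OF EE'])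
    also have "\<dots> = mm R (mm R (mm R (mm R (mm R L E) E') H) (X k)) V i j"
      by (simp add: mm_assoc)
    also have "\<dots> = mm R (mm R (mm R (mm R (mm R L E) E') H) (X k)) (mm R E (mm R E' V)) i j"
      by (rule mm_cong) (simp_all add: right_inv_mult[OF EE'])
    also have "\<dots> = mm R (mm R L E) (mm R (D k) b) i j"
      by (simp add: mm_assoc D_def b_def V_def)
    also have "\<dots> = mm R (mm R L E) (\<lambda>l j. D k l l * b l j) i j"
    proof (intro mm_cong refl)
      fix l assume l: "l < R"
      have "mm R (D k) b l j = (\<Sum>m<R. if m = l then D k l l * b l j else 0)"
        unfolding mm_def using D0 l by (intro sum.cong) auto
      then show "mm R (D k) b l j = D k l l * b l j" using l by simp
    qed
    also have "\<dots> = cpd_sum R a b c i j k"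
      by (simp add: mm_def[of R "mm R L E"] cpd_sum_def a_def c_def algebra_simps)
    finally show ?thesis .
  qed
  have mmF: "mm R A B i j \<in> ?F" if "\<And>l. l < R \<Longrightarrow> A i l \<in> ?F" "\<And>l. l < R \<Longrightarrow> B l j \<in> ?F" for A B i j
    using that by (auto simp: mm_def)
  have Tz: "T i j k = 0" if "\<not> (i < I1 \<and> j < I2 \<and> k < I3)" for i j k
    using T that unfolding tensor_in_def by metis
  have "vec_in ?F I1 (a l)" if "l < R" for l
  proof -
    have "a l i \<in> ?F" for i
      unfolding a_def using TF wF pq uF that
      by (intro mmF) (auto simp: L_def weighted_def modal_left_def E_def)
    moreover have "a l i = 0" if "i \<ge> I1" for i
      using that by (simp add: a_def mm_def L_def weighted_def modal_left_def Tz)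
    ultimately show ?thesis by (auto simp: vec_in_def)
  qed
  moreover have "vec_in ?F I2 (b l)" if "l < R" for l
  proof -
    have "b l j \<in> ?F" for j
      unfolding b_def using TF wF pq HF E'F that
      by (intro mmF) (auto simp: N_def weighted_def modal_right_def)
    moreover have "b l j = 0" if "j \<ge> I2" for j
      using that by (simp add: b_def mm_def N_def weighted_def modal_right_def Tz)
    ultimately show ?thesis by (auto simp: vec_in_def)
  qed
  moreover have "vec_in ?F I3 (c l)" if "l < R" for l
  proof -
    have "c l k \<in> ?F" for k
      unfolding c_def D_def using XF HF E'F uF that by (intro mmF) (auto simp: E_def)
    moreover have "c l k = 0" if "k \<ge> I3" for k
      using that by (simp add: c_def D_def mm_def X modal_slice_def Tz)
    ultimately show ?thesis by (auto simp: vec_in_def)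
  qed
  moreover have "T = cpd_sum R a b c" using T_eq by (intro ext)
  ultimately show ?thesis using that by blast
qed

section \<open>Tensor rank and limits of decomposable tensors\<close>

text \<open>Terms of a decomposition must have nonzero factors, so terms with a zero factor are
  dropped and the rest renumbered. The index type is free since both entry positions and term
  numbers serve as indices.\<close>

lemma is_decomp_of_sum:
  fixes S :: "'x set"
  assumes fin: "finite S"
    and v: "\<And>x. x \<in> S \<Longrightarrow> vec_in F I1 (a x)" "\<And>x. x \<in> S \<Longrightarrow> vec_in F I2 (b x)"
      "\<And>x. x \<in> S \<Longrightarrow> vec_in F I3 (c x)"
    and T: "\<And>i j k. T i j k = (\<Sum>x\<in>S. a x i * b x j * c x k)"
  obtains r a' b' c' where "r \<le> card S" "is_decomp F I1 I2 I3 r a' b' c' T"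
proof -
  define S' where "S' = {x \<in> S. (\<exists>i. a x i \<noteq> 0) \<and> (\<exists>i. b x i \<noteq> 0) \<and> (\<exists>i. c x i \<noteq> 0)}"
  have fin': "finite S'" and sub: "S' \<subseteq> S" using fin by (auto simp: S'_def)
  obtain f where f: "bij_betw f {..<card S'} S'"
    using fin' by (metis bij_betw_from_nat_into_finite)
  have fS: "f l \<in> S'" if "l < card S'" for l using f that by (auto simp: bij_betw_def)
  have "T = cpd_sum (card S') (a \<circ> f) (b \<circ> f) (c \<circ> f)"
  proof (intro ext)
    fix i j k
    have "T i j k = (\<Sum>x\<in>S'. a x i * b x j * c x k)"
      unfolding T using fin by (intro sum.mono_neutral_right) (auto simp: S'_def)
    also have "\<dots> = (\<Sum>l<card S'. a (f l) i * b (f l) j * c (f l) k)"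
      using sum.reindex_bij_betw[OF f, of "\<lambda>x. a x i * b x j * c x k"] by simp
    finally show "T i j k = cpd_sum (card S') (a \<circ> f) (b \<circ> f) (c \<circ> f) i j k"
      by (simp add: cpd_sum_def)
  qed
  then have "is_decomp F I1 I2 I3 (card S') (a \<circ> f) (b \<circ> f) (c \<circ> f) T"
    using fS v sub by (auto simp: is_decomp_def S'_def)
  then show ?thesis using that card_mono[OF fin sub] by blast
qed

text \<open>Expansion into unit tensors, one per entry. It ensures that the \<open>LEAST\<close> in
  \<open>krank\<close> is attained.\<close>

lemma decomp_exists:
  assumes "tensor_in (Kfield F) I1 I2 I3 T"
  shows "\<exists>r a b c. is_decomp (Kfield F) I1 I2 I3 r a b c T"
proof -
  define S where "S = {..<I1} \<times> {..<I2} \<times> {..<I3}"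
  define a where "a = (\<lambda>x i. if i = fst x then T (fst x) (fst (snd x)) (snd (snd x)) else 0)"
  define b where "b = (\<lambda>(x :: nat \<times> nat \<times> nat) j. if j = fst (snd x) then 1 else 0 :: complex)"
  define c where "c = (\<lambda>(x :: nat \<times> nat \<times> nat) k. if k = snd (snd x) then 1 else 0 :: complex)"
  have TF: "T i j k \<in> Kfield F" for i j k
    using assms unfolding tensor_in_def by (metis Kfield_closed(1))
  have Tz: "T i j k = 0" if "\<not> (i < I1 \<and> j < I2 \<and> k < I3)" for i j k
    using assms that unfolding tensor_in_def by metis
  have fin: "finite S" by (simp add: S_def)
  have sum: "T i j k = (\<Sum>x\<in>S. a x i * b x j * c x k)" for i j k
  proof -
    have "a x i * b x j * c x k = (if x = (i, j, k) then T i j k else 0)" for x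
      by (cases x) (simp add: a_def b_def c_def)
    then have "(\<Sum>x\<in>S. a x i * b x j * c x k) = (if (i, j, k) \<in> S then T i j k else 0)"
      using fin by simp
    also have "\<dots> = T i j k" using Tz[of i j k] by (auto simp: S_def)
    finally show ?thesis by simp
  qed
  have "vec_in (Kfield F) I1 (a x)" "vec_in (Kfield F) I2 (b x)" "vec_in (Kfield F) I3 (c x)"
    if "x \<in> S" for x
    using that TF by (auto simp: S_def a_def b_def c_def vec_in_def)
  from is_decomp_of_sum[OF fin this sum] show ?thesis by blast
qed

lemma is_decomp_krank:
  assumes "tensor_in (Kfield F) I1 I2 I3 T"
  shows "\<exists>a b c. is_decomp (Kfield F) I1 I2 I3 (krank (Kfield F) I1 I2 I3 T) a b c T"
  unfolding krank_def using decomp_exists[OF assms]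
  by (rule LeastI_ex[of "\<lambda>r. \<exists>a b c. is_decomp (Kfield F) I1 I2 I3 r a b c T"])

text \<open>Zero third factors pad the sum to exactly \<open>R\<close> terms; the padding is
  reported so that a rank below \<open>R\<close> can be refuted later.\<close>

lemma krank_le_imp_cpd_sum:
  assumes "tensor_in (Kfield F) I1 I2 I3 T" "krank (Kfield F) I1 I2 I3 T \<le> R"
  obtains a b c where "T = cpd_sum R a b c"
    "\<forall>l\<ge>krank (Kfield F) I1 I2 I3 T. c l = (\<lambda>_. 0)"
proof -
  define r where "r = krank (Kfield F) I1 I2 I3 T"
  obtain a b c where T: "T = cpd_sum r a b c"
    using is_decomp_krank[OF assms(1)] by (auto simp: is_decomp_def r_def)
  define c' where "c' = (\<lambda>l. if l < r then c l else (\<lambda>_. 0))"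
  have "cpd_sum r a b c i j k = cpd_sum R a b c' i j k" for i j k
    unfolding cpd_sum_def using assms(2) by (intro sum.mono_neutral_cong_left) (auto simp: c'_def r_def)
  then have "T = cpd_sum R a b c'" unfolding T by (intro ext)
  then show ?thesis using that[of a b c'] by (auto simp: c'_def r_def)
qed

lemma krank_cpd_sum_le:
  assumes "\<And>l. l < R \<Longrightarrow> vec_in F I1 (a l)" "\<And>l. l < R \<Longrightarrow> vec_in F I2 (b l)"
    "\<And>l. l < R \<Longrightarrow> vec_in F I3 (c l)"
  shows "krank F I1 I2 I3 (cpd_sum R a b c) \<le> R"
proof -
  obtain r a' b' c' where "r \<le> card {..<R}" "is_decomp F I1 I2 I3 r a' b' c' (cpd_sum R a b c)"
    by (rule is_decomp_of_sum[of "{..<R}" F I1 a I2 b I3 c "cpd_sum R a b c"])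
      (use assms in \<open>auto simp: cpd_sum_def\<close>)
  moreover from this have "krank F I1 I2 I3 (cpd_sum R a b c) \<le> r"
    unfolding krank_def by (intro Least_le) blast
  ultimately show ?thesis by simp
qed

section \<open>Polynomial identities on the closure\<close>

text \<open>Tensors carry the product topology of the function space, to which closures and
  compactness refer throughout.\<close>

lemma continuous_on_tensor_entry:
  "continuous_on UNIV (\<lambda>t :: nat \<Rightarrow> nat \<Rightarrow> nat \<Rightarrow> 'a::topological_space. t i j k)"
proof -
  have "continuous_on UNIV (\<lambda>t :: nat \<Rightarrow> nat \<Rightarrow> nat \<Rightarrow> 'a. t)" by (rule continuous_on_id)
  then have "continuous_on UNIV (\<lambda>t :: nat \<Rightarrow> nat \<Rightarrow> nat \<Rightarrow> 'a. t i)"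
    by (rule continuous_on_product_then_coordinatewise)
  then have "continuous_on UNIV (\<lambda>t :: nat \<Rightarrow> nat \<Rightarrow> nat \<Rightarrow> 'a. t i j)"
    by (rule continuous_on_product_then_coordinatewise)
  then show ?thesis by (rule continuous_on_product_then_coordinatewise)
qed

lemma mm_divide:
  "mm n (\<lambda>i j. A i j / d) B = (\<lambda>i j. mm n A B i j / d)"
  "mm n A (\<lambda>i j. B i j / d) = (\<lambda>i j. mm n A B i j / d)"
  by (intro ext; simp add: mm_def sum_divide_distrib)+

lemma continuous_on_mm:
  assumes "\<And>l. l < n \<Longrightarrow> continuous_on S (\<lambda>x. A x i l)" "\<And>l. l < n \<Longrightarrow> continuous_on S (\<lambda>x. B x l j)"
  shows "continuous_on S (\<lambda>x. mm n (A x) (B x) i j)"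
  unfolding mm_def using assms by (intro continuous_intros) auto

text \<open>Multiplying by \<open>det G\<close> and replacing the inverse of \<open>G\<close> by the adjugate turns the identities
  for decomposable tensors into polynomial ones, which therefore persist on the closure.\<close>

lemma closure_cpd_identities:
  assumes cl: "T \<in> closure {T. \<exists>a b c. T = cpd_sum R a b c}"
    and H: "right_inv R H (weighted I3 w (modal_slice I1 I2 p q T))"
  shows "mm R (modal_slice I1 I2 p q T j) (mm R H (modal_slice I1 I2 p q T k)) =
         mm R (modal_slice I1 I2 p q T k) (mm R H (modal_slice I1 I2 p q T j))" (is ?comm)
    and "T i1 i2 k = mm R (weighted I3 w (modal_left I2 q T)) (mm R H (mm R (modal_slice I1 I2 p q T k)
           (mm R H (weighted I3 w (modal_right I1 p T))))) i1 i2" (is ?rec)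
proof -
  define X where "X = (\<lambda>t. modal_slice I1 I2 p q t)"
  define G where "G = (\<lambda>t. weighted I3 w (X t))"
  define d where "d = (\<lambda>t. det_n R (G t))"
  define N where "N = (\<lambda>t. adjugate_n R (G t))"
  define L where "L = (\<lambda>t. weighted I3 w (modal_left I2 q t))"
  define Q where "Q = (\<lambda>t. weighted I3 w (modal_right I1 p t))"
  have cX: "continuous_on UNIV (\<lambda>t. X t k \<alpha> \<beta>)" for k \<alpha> \<beta>
    unfolding X_def modal_slice_def by (intro continuous_intros continuous_on_tensor_entry)
  have cG: "continuous_on UNIV (\<lambda>t. G t \<alpha> \<beta>)" for \<alpha> \<beta>
    unfolding G_def weighted_def by (intro continuous_intros cX)
  have cd: "continuous_on UNIV d"
    unfolding d_def det_n_def by (intro continuous_intros cG)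
  have cN: "continuous_on UNIV (\<lambda>t. N t i j)" if "i < R" "j < R" for i j
    unfolding N_def by (intro continuous_on_adjugate_n cG that)
  have cL: "continuous_on UNIV (\<lambda>t. L t \<alpha> \<beta>)" for \<alpha> \<beta>
    unfolding L_def weighted_def modal_left_def by (intro continuous_intros continuous_on_tensor_entry)
  have cQ: "continuous_on UNIV (\<lambda>t. Q t \<alpha> \<beta>)" for \<alpha> \<beta>
    unfolding Q_def weighted_def modal_right_def by (intro continuous_intros continuous_on_tensor_entry)
  have inv: "right_inv R (\<lambda>i j. N t i j / d t) (G t)" if "d t \<noteq> 0" for t
    using adjugate_n_inverse(2)[of R "G t"] that by (simp add: N_def d_def)
  let ?Y = "{T. \<exists>a b c. T = cpd_sum R a b c}"
  have HG: "right_inv R H (G T)" using H by (simp add: G_def X_def)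
  have dT: "d T \<noteq> 0" using right_inv_det[OF HG] by (auto simp: d_def)
  have HN: "H i j = N T i j / d T" if "i < R" "j < R" for i j
    using right_inv_unique[OF HG right_inv_sym[OF inv[OF dT]] that] .
  have mmH: "mm R H B i j = mm R (N T) B i j / d T" if "i < R" for B i j
    using HN that by (simp add: mm_def sum_divide_distrib)

  \<comment> \<open>The leading determinant makes the expression vanish also at decomposable tensors
    with singular \<open>G\<close>, so it is zero on all of \<open>?Y\<close>.\<close>
  have 1: "d T * (mm R (X T j) (mm R (N T) (X T k)) \<alpha> \<beta> - mm R (X T k) (mm R (N T) (X T j)) \<alpha> \<beta>) = 0"
    (is "?f T = 0") for \<alpha> \<beta>
  proof -
    have "continuous_on UNIV ?f"
      by (intro continuous_intros continuous_on_mm cd cX cN)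
    then have "closed {t. ?f t = 0}" by (intro closed_Collect_eq continuous_on_const)
    moreover have "?Y \<subseteq> {t. ?f t = 0}"
    proof safe
      fix a b c
      let ?t = "cpd_sum R a b c"
      show "?f ?t = 0"
      proof (cases "d ?t = 0")
        case False
        have "mm R (X ?t j) (mm R (\<lambda>i j. N ?t i j / d ?t) (X ?t k)) =
            mm R (X ?t k) (mm R (\<lambda>i j. N ?t i j / d ?t) (X ?t j))"
          unfolding X_def
          by (rule cpd_slices_commute[OF refl]) (use inv[OF False] in \<open>simp add: G_def X_def\<close>)
        then show ?thesis using False by (simp add: mm_divide fun_eq_iff)
      qed simp
    qed
    ultimately have "closure ?Y \<subseteq> {t. ?f t = 0}" by (rule closure_minimal[rotated])
    then show ?thesis using cl by blast
  qed
  have "mm R (X T j) (mm R H (X T k)) \<alpha> \<beta> = mm R (X T k) (mm R H (X T j)) \<alpha> \<beta>" for \<alpha> \<beta>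
  proof -
    have "mm R (X T j) (mm R H (X T k)) \<alpha> \<beta> = mm R (X T j) (\<lambda>i l. mm R (N T) (X T k) i l / d T) \<alpha> \<beta>"
      for j k by (rule mm_cong) (simp_all add: mmH)
    then show ?thesis using 1[of \<alpha> \<beta>] dT by (simp add: mm_divide)
  qed
  then show ?comm unfolding X_def by (intro ext)

  \<comment> \<open>The two inverses cost two determinants; the third one again covers the singular
    case.\<close>
  have 2: "d T * (d T * d T * T i1 i2 k -
      mm R (L T) (mm R (N T) (mm R (X T k) (mm R (N T) (Q T)))) i1 i2) = 0" (is "?g T = 0")
  proof -
    have "continuous_on UNIV ?g"
      by (intro continuous_intros continuous_on_mm cd cX cN cL cQ continuous_on_tensor_entry)
    then have "closed {t. ?g t = 0}" by (intro closed_Collect_eq continuous_on_const)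
    moreover have "?Y \<subseteq> {t. ?g t = 0}"
    proof safe
      fix a b c
      let ?t = "cpd_sum R a b c"
      show "?g ?t = 0"
      proof (cases "d ?t = 0")
        case False
        have "?t i1 i2 k = mm R (L ?t) (mm R (\<lambda>i j. N ?t i j / d ?t) (mm R (X ?t k)
            (mm R (\<lambda>i j. N ?t i j / d ?t) (Q ?t)))) i1 i2"
          unfolding X_def L_def Q_def
          by (rule cpd_reconstruct[OF refl]) (use inv[OF False] in \<open>simp add: G_def X_def\<close>)
        then show ?thesis using False by (simp add: mm_divide field_simps)
      qed simp
    qed
    ultimately have "closure ?Y \<subseteq> {t. ?g t = 0}" by (rule closure_minimal[rotated])
    then show ?thesis using cl by blast
  qed
  have "mm R (L T) (mm R H (mm R (X T k) (mm R H (Q T)))) i1 i2 =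
      mm R (L T) (\<lambda>i l. mm R (N T) (mm R (X T k) (mm R H (Q T))) i l / d T) i1 i2"
    by (rule mm_cong) (simp_all add: mmH)
  also have "\<dots> = mm R (mm R (mm R (L T) (N T)) (X T k)) (mm R H (Q T)) i1 i2 / d T"
    by (simp add: mm_divide mm_assoc)
  also have "\<dots> = mm R (mm R (mm R (L T) (N T)) (X T k)) (\<lambda>i l. mm R (N T) (Q T) i l / d T) i1 i2 / d T"
    by (rule arg_cong[where f="\<lambda>x. x / d T"], rule mm_cong) (simp_all add: mmH)
  also have "\<dots> = mm R (L T) (mm R (N T) (mm R (X T k) (mm R (N T) (Q T)))) i1 i2 / d T / d T"
    by (simp add: mm_divide mm_assoc)
  also have "\<dots> = T i1 i2 k" using 2 dT by (simp add: field_simps)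
  finally show ?rec by (simp add: L_def Q_def X_def)
qed

section \<open>Uniqueness of decompositions\<close>

text \<open>Dual vectors certify full column rank of the first two factor matrices. From D B H A =
  I, the rows of D B H are dual to the columns of A and the rescaled columns of H A to the rows of
  B; composing with \<open>p\<close> and \<open>q\<close> gives duals of the original
  factors.\<close>

lemma cpd_duals:
  assumes T: "T = cpd_sum R a b c"
    and H: "right_inv R H (weighted I3 w (modal_slice I1 I2 p q T))"
  obtains x y where "\<forall>l<R. \<forall>m<R. dotn I1 (x l) (a m) = (if l = m then 1 else 0)"
    "\<forall>l<R. \<forall>m<R. dotn I2 (y l) (b m) = (if l = m then 1 else 0)"
    "\<forall>l<R. dotn I3 w (c l) \<noteq> 0"
proof -
  define A where "A = (\<lambda>\<alpha> l. dotn I1 (p \<alpha>) (a l))"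
  define B where "B = (\<lambda>l \<beta>. dotn I2 (q \<beta>) (b l))"
  define d where "d = (\<lambda>l. dotn I3 w (c l))"
  have X: "modal_slice I1 I2 p q T k = mm R A (row_scale (\<lambda>l. c l k) B)" for k
    by (simp add: T modal_slice_cpd A_def B_def)
  have H': "right_inv R H (mm R A (row_scale d B))"
    using H unfolding X weighted_row_scale d_def .
  note N = diag_factor_inverse[OF H']
  define M where "M = row_scale d (mm R B H)"
  define x where "x = (\<lambda>l i. \<Sum>\<alpha><R. M l \<alpha> * p \<alpha> i)"
  define y where "y = (\<lambda>m j. \<Sum>\<beta><R. d m * mm R H A \<beta> m * q \<beta> j)"
  have "dotn I1 (x l) (a m) = (if l = m then 1 else 0)" if "l < R" "m < R" for l m
  proof -
    have "dotn I1 (x l) (a m) = mm R M A l m"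
      unfolding dotn_def x_def mm_def A_def sum_distrib_left sum_distrib_right
      by (subst sum.swap) (simp add: mult.assoc)
    also have "\<dots> = d l * mm R B (mm R H A) l m"
      unfolding M_def row_scale_mm[symmetric] mm_assoc by (simp add: row_scale_def)
    finally show ?thesis using N[OF that] by simp
  qed
  moreover have "dotn I2 (y l) (b m) = (if l = m then 1 else 0)" if "l < R" "m < R" for l m
  proof -
    have "dotn I2 (y l) (b m) = (\<Sum>\<beta><R. d l * mm R H A \<beta> l * B m \<beta>)"
      unfolding dotn_def y_def B_def sum_distrib_left sum_distrib_right
      by (subst sum.swap) (simp add: mult.assoc)
    also have "\<dots> = d l * mm R B (mm R H A) m l"
      by (simp add: mm_def[of R B] sum_distrib_left algebra_simps)
    finally show ?thesis using N[OF that(2,1)] N[OF that(2,2)] by (auto split: if_splits)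
  qed
  moreover have "d l \<noteq> 0" if "l < R" for l using N[OF that that] by auto
  ultimately show ?thesis using that[of x y] by (simp add: d_def)
qed

text \<open>Parallelism in the plane, written as a vanishing determinant, is passed on through a
  nonzero middle vector.\<close>

lemma parallel_trans:
  fixes x0 :: complex
  assumes "x0 * y1 = x1 * y0" "y0 * z1 = y1 * z0" "y0 \<noteq> 0 \<or> y1 \<noteq> 0"
  shows "x0 * z1 = x1 * z0"
proof -
  have "y0 * (x0 * z1 - x1 * z0) = x0 * (y0 * z1) - (x1 * y0) * z0" by (simp add: algebra_simps)
  also have "\<dots> = 0" unfolding assms(2) assms(1)[symmetric] by simp
  finally have 1: "y0 * (x0 * z1 - x1 * z0) = 0" .
  have "y1 * (x0 * z1 - x1 * z0) = (x0 * y1) * z1 - x1 * (y1 * z0)" by (simp add: algebra_simps)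
  also have "\<dots> = 0" unfolding assms(1) assms(2)[symmetric] by simp
  finally show ?thesis using 1 assms(3) by auto
qed

lemma dotn_scale: "dotn n h (\<lambda>k. x * c k) = x * dotn n h c"
  by (simp add: dotn_def sum_distrib_left algebra_simps)

text \<open>Contracting the two decompositions with a dual vector \<open>x l\<close> of the first and a dual vector
  \<open>y' m\<close> of the second gives \<open>b\<^sub>l(y'\<^sub>m) c\<^sub>l = a'\<^sub>m(x\<^sub>l) c'\<^sub>m\<close>, so the nonzero pattern of these
  coefficients is a permutation matrix.\<close>

lemma cpd_sum_unique:
  assumes eq: "cpd_sum R a b c = cpd_sum R a' b' c'"
    and x: "\<forall>l<R. \<forall>m<R. dotn I1 (x l) (a m) = (if l = m then 1 else 0)"
    and x': "\<forall>l<R. \<forall>m<R. dotn I1 (x' l) (a' m) = (if l = m then 1 else 0)"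
    and y': "\<forall>l<R. \<forall>m<R. dotn I2 (y' l) (b' m) = (if l = m then 1 else 0)"
    and c: "\<And>l. l < R \<Longrightarrow> dotn I3 h0 (c l) \<noteq> 0 \<or> dotn I3 h1 (c l) \<noteq> 0"
    and c': "\<And>l. l < R \<Longrightarrow> dotn I3 h0 (c' l) \<noteq> 0 \<or> dotn I3 h1 (c' l) \<noteq> 0"
    and np: "\<And>l m. l < R \<Longrightarrow> m < R \<Longrightarrow> l \<noteq> m \<Longrightarrow>
      dotn I3 h0 (c l) * dotn I3 h1 (c m) \<noteq> dotn I3 h1 (c l) * dotn I3 h0 (c m)"
    and np': "\<And>l m. l < R \<Longrightarrow> m < R \<Longrightarrow> l \<noteq> m \<Longrightarrow>
      dotn I3 h0 (c' l) * dotn I3 h1 (c' m) \<noteq> dotn I3 h1 (c' l) * dotn I3 h0 (c' m)"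
  shows "\<exists>\<sigma> \<alpha> \<beta> \<gamma>. \<sigma> permutes {..<R} \<and>
           (\<forall>l<R. a' l = (\<lambda>i. \<alpha> l * a (\<sigma> l) i) \<and> b' l = (\<lambda>i. \<beta> l * b (\<sigma> l) i) \<and>
                  c' l = (\<lambda>i. \<gamma> l * c (\<sigma> l) i))"
proof -
  define \<alpha> where "\<alpha> = (\<lambda>l m. dotn I1 (x l) (a' m))"
  define \<beta> where "\<beta> = (\<lambda>l m. dotn I2 (y' m) (b l))"
  have contract1: "(\<Sum>i<I1. z i * cpd_sum R a b c i j k) = (\<Sum>m<R. dotn I1 z (a m) * b m j * c m k)"
    for z a b c j k
    unfolding cpd_sum_def dotn_def sum_distrib_left sum_distrib_right
    by (subst sum.swap) (simp add: mult.assoc)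
  have contract2: "(\<Sum>j<I2. z j * cpd_sum R a b c i j k) = (\<Sum>m<R. a m i * dotn I2 z (b m) * c m k)"
    for z a b c i k
    unfolding cpd_sum_def dotn_def sum_distrib_left sum_distrib_right
    by (subst sum.swap) (simp add: algebra_simps)
  have B: "b l j * c l k = (\<Sum>m<R. \<alpha> l m * b' m j * c' m k)" if "l < R" for l j k
  proof -
    have "(\<Sum>m<R. dotn I1 (x l) (a m) * b m j * c m k) = (\<Sum>m<R. if m = l then b l j * c l k else 0)"
      using x that by (intro sum.cong) auto
    then show ?thesis
      using that contract1[of "x l" a b c j k] contract1[of "x l" a' b' c' j k]
      unfolding eq \<alpha>_def by simp
  qed
  have A: "a' m i * c' m k = (\<Sum>l<R. a l i * \<beta> l m * c l k)" if "m < R" for m i k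
  proof -
    have "(\<Sum>l<R. a' l i * dotn I2 (y' m) (b' l) * c' l k) = (\<Sum>l<R. if l = m then a' m i * c' m k else 0)"
      using y' that by (intro sum.cong) auto
    then show ?thesis
      using that contract2[of "y' m" a b c i k] contract2[of "y' m" a' b' c' i k]
      unfolding eq \<beta>_def by simp
  qed
  have ab: "\<beta> l m * c l k = \<alpha> l m * c' m k" if "l < R" "m < R" for l m k
  proof -
    have "\<beta> l m * c l k = (\<Sum>j<I2. y' m j * (b l j * c l k))"
      by (simp add: \<beta>_def dotn_def sum_distrib_right mult.assoc)
    also have "\<dots> = (\<Sum>s<R. \<alpha> l s * dotn I2 (y' m) (b' s) * c' s k)"
      unfolding B[OF that(1)] dotn_def sum_distrib_left sum_distrib_right
      by (subst sum.swap) (simp add: algebra_simps)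
    also have "\<dots> = (\<Sum>s<R. if s = m then \<alpha> l m * c' m k else 0)"
      using y' that by (intro sum.cong) auto
    finally show ?thesis using that by simp
  qed
  have abh: "\<beta> l m * dotn I3 h (c l) = \<alpha> l m * dotn I3 h (c' m)" if "l < R" "m < R" for l m h
    using ab[OF that] by (simp add: dotn_scale[symmetric])
  have cnz: "\<exists>k. c l k \<noteq> 0" if "l < R" for l
  proof (rule ccontr)
    assume "\<not> ?thesis"
    then have "c l = (\<lambda>_. 0)" by auto
    then show False using c[OF that] by (simp add: dotn_def)
  qed
  have cnz': "\<exists>k. c' l k \<noteq> 0" if "l < R" for l
  proof (rule ccontr)
    assume "\<not> ?thesis"
    then have "c' l = (\<lambda>_. 0)" by auto
    then show False using c'[OF that] by (simp add: dotn_def)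
  qed
  have nz: "\<alpha> l m = 0 \<longleftrightarrow> \<beta> l m = 0" if "l < R" "m < R" for l m
  proof -
    obtain k k' where "c l k \<noteq> 0" "c' m k' \<noteq> 0" using cnz[OF \<open>l < R\<close>] cnz'[OF \<open>m < R\<close>] by blast
    then show ?thesis using ab[OF that, of k] ab[OF that, of k'] by auto
  qed
  have par: "dotn I3 h0 (c l) * dotn I3 h1 (c' m) = dotn I3 h1 (c l) * dotn I3 h0 (c' m)"
    if "l < R" "m < R" "\<alpha> l m \<noteq> 0" for l m
  proof -
    have "\<alpha> l m * (dotn I3 h0 (c l) * dotn I3 h1 (c' m)) = dotn I3 h0 (c l) * (\<beta> l m * dotn I3 h1 (c l))"
      unfolding abh[OF that(1,2)] by simp
    also have "\<dots> = (\<beta> l m * dotn I3 h0 (c l)) * dotn I3 h1 (c l)" by simp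
    also have "\<dots> = \<alpha> l m * (dotn I3 h1 (c l) * dotn I3 h0 (c' m))"
      unfolding abh[OF that(1,2)] by simp
    finally show ?thesis using that(3) by simp
  qed
  \<comment> \<open>Two nonzero entries in one column of \<alpha> would make two different
    \<open>c l\<close> parallel to the same \<open>c' m\<close> in the coordinates given by
    \<open>h0\<close> and \<open>h1\<close>.\<close>
  have uniq_l: "l = l'" if "l < R" "l' < R" "m < R" "\<alpha> l m \<noteq> 0" "\<alpha> l' m \<noteq> 0" for l l' m
    using np[of l l'] that
      parallel_trans[OF par[of l m], of "dotn I3 h1 (c l')" "dotn I3 h0 (c l')"] par[of l' m] c'[of m]
    by (auto simp: mult.commute)
  have uniq_m: "m = m'" if "l < R" "m < R" "m' < R" "\<alpha> l m \<noteq> 0" "\<alpha> l m' \<noteq> 0" for l m m'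
    using np'[of m m'] that
      parallel_trans[of "dotn I3 h0 (c' m)" "dotn I3 h1 (c l)" "dotn I3 h1 (c' m)" "dotn I3 h0 (c l)"
        "dotn I3 h1 (c' m')" "dotn I3 h0 (c' m')"] par[of l m] par[of l m'] c[of l]
    by (auto simp: mult.commute)
  have ex: "\<exists>l<R. \<alpha> l m \<noteq> 0" if "m < R" for m
  proof (rule ccontr)
    assume "\<not> (\<exists>l<R. \<alpha> l m \<noteq> 0)"
    then have "a' m i * c' m k = 0" for i k
      unfolding A[OF that] using nz that by (intro sum.neutral) auto
    then have "a' m i = 0" for i using cnz'[OF that] by auto
    then have "dotn I1 (x' m) (a' m) = 0" by (simp add: dotn_def)
    then show False using x' that by simp
  qed
  define \<sigma> where "\<sigma> = (\<lambda>m. if m < R then SOME l. l < R \<and> \<alpha> l m \<noteq> 0 else m)"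
  have \<sigma>: "\<sigma> m < R \<and> \<alpha> (\<sigma> m) m \<noteq> 0" if "m < R" for m
    unfolding \<sigma>_def using someI_ex[OF ex[OF that]] that by simp
  have "inj_on \<sigma> {..<R}"
  proof (rule inj_onI)
    fix m m' assume "m \<in> {..<R}" "m' \<in> {..<R}" and eq: "\<sigma> m = \<sigma> m'"
    then have "m < R" "m' < R" by auto
    from \<sigma>[OF this(1)] \<sigma>[OF this(2)] this show "m = m'"
      unfolding eq by (intro uniq_m[of "\<sigma> m'"]) auto
  qed
  moreover have "\<sigma> ` {..<R} \<subseteq> {..<R}" using \<sigma> by auto
  ultimately have "bij_betw \<sigma> {..<R} {..<R}" by (simp add: bij_betw_def endo_inj_surj)
  then have perm: "\<sigma> permutes {..<R}" by (rule bij_imp_permutes) (simp add: \<sigma>_def)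
  have "a' m i = \<alpha> (\<sigma> m) m * a (\<sigma> m) i" if "m < R" for m i
  proof -
    obtain k where k: "c' m k \<noteq> 0" using cnz'[OF \<open>m < R\<close>] by blast
    have z: "\<beta> l m = 0" if "l < R" "l \<noteq> \<sigma> m" for l
      using uniq_l[of l "\<sigma> m" m] nz[of l m] \<sigma>[OF \<open>m < R\<close>] \<open>m < R\<close> that by blast
    have "a' m i * c' m k = (\<Sum>l<R. if l = \<sigma> m then a (\<sigma> m) i * (\<beta> (\<sigma> m) m * c (\<sigma> m) k) else 0)"
      unfolding A[OF that]
      by (intro sum.cong refl) (use z in \<open>auto simp: mult.assoc\<close>)
    also have "\<dots> = a (\<sigma> m) i * (\<beta> (\<sigma> m) m * c (\<sigma> m) k)" using \<sigma>[OF that] by simp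
    also have "\<dots> = a (\<sigma> m) i * (\<alpha> (\<sigma> m) m * c' m k)" using ab \<sigma> that by simp
    finally show ?thesis using k by simp
  qed
  moreover have "b' m j = 1 / \<beta> (\<sigma> m) m * b (\<sigma> m) j" if "m < R" for m j
  proof -
    have l: "\<sigma> m < R" using \<sigma> that by blast
    obtain k where k: "c (\<sigma> m) k \<noteq> 0" using cnz[OF l] by blast
    have z: "\<alpha> (\<sigma> m) s = 0" if "s < R" "s \<noteq> m" for s
      using uniq_m[of "\<sigma> m" s m] \<sigma>[OF \<open>m < R\<close>] \<open>m < R\<close> that by blast
    have "b (\<sigma> m) j * c (\<sigma> m) k = (\<Sum>s<R. if s = m then b' m j * (\<alpha> (\<sigma> m) m * c' m k) else 0)"
      unfolding B[OF l]
      by (intro sum.cong refl) (use z in \<open>auto simp: algebra_simps\<close>)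
    also have "\<dots> = b' m j * (\<alpha> (\<sigma> m) m * c' m k)" using that by simp
    also have "\<dots> = b' m j * (\<beta> (\<sigma> m) m * c (\<sigma> m) k)" using ab l that by simp
    finally have "b (\<sigma> m) j = b' m j * \<beta> (\<sigma> m) m" using k by simp
    moreover have "\<beta> (\<sigma> m) m \<noteq> 0" using \<sigma>[OF that] nz that by blast
    ultimately show ?thesis by simp
  qed
  moreover have "c' m k = \<beta> (\<sigma> m) m / \<alpha> (\<sigma> m) m * c (\<sigma> m) k" if "m < R" for m k
    using ab[of "\<sigma> m" m k] \<sigma>[OF that] that by (simp add: field_simps)
  \<comment> \<open>The three scalars multiply to 1, as they must for equal rank one terms.\<close>
  ultimately show ?thesis
    by (intro exI[of _ \<sigma>] exI[of _ "\<lambda>m. \<alpha> (\<sigma> m) m"] exI[of _ "\<lambda>m. 1 / \<beta> (\<sigma> m) m"]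
        exI[of _ "\<lambda>m. \<beta> (\<sigma> m) m / \<alpha> (\<sigma> m) m"] conjI perm) (auto intro!: ext)
qed

lemma det_n_diag_factor:
  "det_n R (mm R A (row_scale d B)) = det_n R A * (\<Prod>l<R. d l) * det_n R B"
proof -
  have "det_n R (row_scale d B) = det_n R (mm R (\<lambda>i j. if i = j then d i else 0) B)"
    by (rule det_n_cong) (simp add: mm_def row_scale_def if_distrib[where f="\<lambda>x. x * _"] cong: if_cong)
  then show ?thesis by (simp add: det_n_mm det_n_diag)
qed

text \<open>The determinant of the pencil is det A det B times the product of the forms x e0_l + y
  e1_l. Forms are matched through zeros: at the zero of the r-th given form some e_l vanishes too,
  hence is parallel to it. The choice \<phi> is injective as the given forms are pairwise
  non-parallel, so it hits every l, and non-parallelism carries over.\<close>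

lemma simple_pencil_cpd:
  assumes T: "T = cpd_sum R a b c" and X: "X = modal_slice I1 I2 p q T"
    and simple: "simple_tensor (Kfield F) R 2 (pencil (weighted I3 h0 X) (weighted I3 h1 X))"
    and lm: "l < R" "m < R" "l \<noteq> m"
  shows "dotn I3 h0 (c l) * dotn I3 h1 (c m) \<noteq> dotn I3 h1 (c l) * dotn I3 h0 (c m)"
proof -
  let ?F = "Kfield F"
  define A where "A = (\<lambda>\<alpha> l. dotn I1 (p \<alpha>) (a l))"
  define B where "B = (\<lambda>l \<beta>. dotn I2 (q \<beta>) (b l))"
  define e0 e1 where "e0 l = dotn I3 h0 (c l)" and "e1 l = dotn I3 h1 (c l)" for l
  have X': "X k = mm R A (row_scale (\<lambda>l. c l k) B)" for k
    by (simp add: X T modal_slice_cpd A_def B_def)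
  define P Q where "P = weighted I3 h0 X" and "Q = weighted I3 h1 X"
  have P: "P = mm R A (row_scale e0 B)"
    unfolding P_def e0_def weighted_row_scale[symmetric] X'[symmetric] ..
  have Q: "Q = mm R A (row_scale e1 B)"
    unfolding Q_def e1_def weighted_row_scale[symmetric] X'[symmetric] ..
  obtain g0 g1 lf where g: "g0 \<in> ?F" "g1 \<in> ?F"
    and lf: "\<forall>r<R. \<forall>k. lf r k \<in> ?F"
    and np: "\<forall>r<R. \<forall>s<R. r \<noteq> s \<longrightarrow> lf r 0 * lf s 1 \<noteq> lf r 1 * lf s (0::nat)"
    and det: "\<forall>x\<in>?F. \<forall>y\<in>?F.
       det_n R (\<lambda>\<alpha> \<beta>. x * P \<alpha> \<beta> + y * Q \<alpha> \<beta>) = (\<Prod>r<R. lf r 0 * x + lf r 1 * y)"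
    and nz: "det_n R (\<lambda>\<alpha> \<beta>. g0 * P \<alpha> \<beta> + g1 * Q \<alpha> \<beta>) \<noteq> 0"
    by (rule simple_pencil_forms[OF simple[folded P_def Q_def]])
  note lf = lf[rule_format] and np = np[rule_format] and det = det[rule_format]
  have det': "det_n R (\<lambda>\<alpha> \<beta>. x * P \<alpha> \<beta> + y * Q \<alpha> \<beta>) =
      det_n R A * (\<Prod>l<R. x * e0 l + y * e1 l) * det_n R B" for x y
    unfolding P Q det_n_diag_factor[symmetric]
    by (rule det_n_cong) (simp add: mm_def row_scale_def sum_distrib_left sum.distrib[symmetric] algebra_simps)
  have AB: "det_n R A \<noteq> 0" "det_n R B \<noteq> 0" and eg: "\<And>l. l < R \<Longrightarrow> g0 * e0 l + g1 * e1 l \<noteq> 0"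
    using nz unfolding det' by auto
  have enz: "e0 l \<noteq> 0 \<or> e1 l \<noteq> 0" if "l < R" for l using eg[OF that] by auto
  have "\<exists>l<R. lf r 0 * e1 l = lf r 1 * e0 l" if "r < R" for r
  proof -
    have 0: "(\<Prod>s<R. lf s 0 * lf r 1 + lf s 1 * (- lf r 0)) = 0"
      using that by (intro prod_zero) (auto intro!: bexI[of _ r])
    have "det_n R (\<lambda>\<alpha> \<beta>. lf r 1 * P \<alpha> \<beta> + (- lf r 0) * Q \<alpha> \<beta>) = 0"
      unfolding det[OF lf[OF that] Kfield_closed(7)[OF lf[OF that]]] by (rule 0)
    then have "(\<Prod>l<R. lf r 1 * e0 l + (- lf r 0) * e1 l) = 0" unfolding det' using AB by simp
    then obtain l where "l < R" "lf r 1 * e0 l + (- lf r 0) * e1 l = 0"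
      unfolding prod_zero_iff[OF finite_lessThan] by blast
    then show ?thesis by (intro exI[of _ l]) simp
  qed
  then have ex: "\<exists>l. l < R \<and> lf r 0 * e1 l = lf r 1 * e0 l" if "r < R" for r using that by blast
  define \<phi> where "\<phi> r = (SOME l. l < R \<and> lf r 0 * e1 l = lf r 1 * e0 l)" for r
  have \<phi>: "\<phi> r < R" "lf r 0 * e1 (\<phi> r) = lf r 1 * e0 (\<phi> r)" if "r < R" for r
    using someI_ex[OF ex[OF that]] unfolding \<phi>_def by blast+
  have "inj_on \<phi> {..<R}"
  proof (rule inj_onI, rule ccontr)
    fix r s assume rs: "r \<in> {..<R}" "s \<in> {..<R}" "\<phi> r = \<phi> s" "r \<noteq> s"
    have "e0 (\<phi> r) * lf s 1 = e1 (\<phi> r) * lf s 0"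
      using \<phi>(2)[of s] rs by (simp add: mult.commute)
    then have "lf r 0 * lf s 1 = lf r 1 * lf s 0"
      using parallel_trans[OF \<phi>(2)[of r]] \<phi>(1)[of r] enz rs by blast
    then show False using np rs by simp
  qed
  moreover have "\<phi> ` {..<R} \<subseteq> {..<R}" using \<phi> by auto
  ultimately have "\<phi> ` {..<R} = {..<R}" by (simp add: endo_inj_surj)
  then obtain r s where rs: "r < R" "s < R" "l = \<phi> r" "m = \<phi> s"
    using lm by (metis imageE lessThan_iff)
  show ?thesis
  proof
    assume eq: "dotn I3 h0 (c l) * dotn I3 h1 (c m) = dotn I3 h1 (c l) * dotn I3 h0 (c m)"
    have "lf r 0 * e1 m = lf r 1 * e0 m"
      using parallel_trans[OF \<phi>(2)[OF rs(1)], of "e1 m" "e0 m"] eq enz[OF lm(1)] rs(3)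
      by (simp add: e0_def e1_def)
    moreover have "e0 m * lf s 1 = e1 m * lf s 0"
      using \<phi>(2)[OF rs(2)] rs(4) by (simp add: mult.commute)
    ultimately have "lf r 0 * lf s 1 = lf r 1 * lf s 0"
      using parallel_trans enz[OF lm(2)] by blast
    then show False using np rs lm by auto
  qed
qed

lemma simple_pencil_unique_CPD:
  assumes Tin: "tensor_in (Kfield F) I1 I2 I3 T" and kr: "krank (Kfield F) I1 I2 I3 T \<le> R"
    and X: "X = modal_slice I1 I2 p q T"
    and simple: "simple_tensor (Kfield F) R 2 (pencil (weighted I3 h0 X) (weighted I3 h1 X))"
  shows "unique_CPD (Kfield F) I1 I2 I3 T"
proof -
  let ?F = "Kfield F"
  define P Q where "P = weighted I3 h0 X" and "Q = weighted I3 h1 X"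
  obtain g0 g1 where nz: "det_n R (\<lambda>\<alpha> \<beta>. g0 * P \<alpha> \<beta> + g1 * Q \<alpha> \<beta>) \<noteq> 0"
    by (rule simple_pencil_forms[OF simple[folded P_def Q_def]])
  define w where "w = (\<lambda>k. g0 * h0 k + g1 * h1 k)"
  have w: "weighted I3 w X = (\<lambda>\<alpha> \<beta>. g0 * P \<alpha> \<beta> + g1 * Q \<alpha> \<beta>)"
    by (intro ext)
      (simp add: w_def weighted_def P_def Q_def sum_distrib_left sum.distrib[symmetric] algebra_simps)
  obtain H where "right_inv R H (\<lambda>\<alpha> \<beta>. g0 * P \<alpha> \<beta> + g1 * Q \<alpha> \<beta>)"
    using adjugate_n_inverse(2)[OF nz] by blast
  then have H: "right_inv R H (weighted I3 w (modal_slice I1 I2 p q T))"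
    by (simp add: w[symmetric] X)
  have wdot: "dotn I3 w v = g0 * dotn I3 h0 v + g1 * dotn I3 h1 v" for v
    by (simp add: w_def dotn_def sum_distrib_left sum.distrib[symmetric] algebra_simps)
  \<comment> \<open>With rank below \<open>R\<close> the padded decomposition would contain a zero
    third factor, on which \<open>w\<close> vanishes, against \<open>cpd_duals\<close>. So every CPD
    has exactly \<open>R\<close> terms.\<close>
  have kR: "krank ?F I1 I2 I3 T = R"
  proof -
    obtain a b c where T: "T = cpd_sum R a b c" and cz: "\<forall>l\<ge>krank ?F I1 I2 I3 T. c l = (\<lambda>_. 0)"
      by (rule krank_le_imp_cpd_sum[OF Tin kr])
    have "\<forall>l<R. dotn I3 w (c l) \<noteq> 0"
      by (rule cpd_duals[OF T H])
    then have "\<not> krank ?F I1 I2 I3 T < R" using cz by (auto simp: dotn_def)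
    then show ?thesis using kr by simp
  qed
  show ?thesis
    unfolding unique_CPD_def kR
  proof (intro conjI allI impI)
    show "\<exists>a b c. is_CPD ?F I1 I2 I3 T a b c"
      using is_decomp_krank[OF Tin] by (simp add: is_CPD_def)
    fix a b c a' b' c'
    assume "is_CPD ?F I1 I2 I3 T a b c \<and> is_CPD ?F I1 I2 I3 T a' b' c'"
    then have T: "T = cpd_sum R a b c" and T': "T = cpd_sum R a' b' c'"
      by (auto simp: is_CPD_def is_decomp_def kR)
    obtain x y where x: "\<forall>l<R. \<forall>m<R. dotn I1 (x l) (a m) = (if l = m then 1 else 0)"
      and c: "\<forall>l<R. dotn I3 w (c l) \<noteq> 0"
      by (rule cpd_duals[OF T H])
    obtain x' y' where x': "\<forall>l<R. \<forall>m<R. dotn I1 (x' l) (a' m) = (if l = m then 1 else 0)"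
      and y': "\<forall>l<R. \<forall>m<R. dotn I2 (y' l) (b' m) = (if l = m then 1 else 0)"
      and c': "\<forall>l<R. dotn I3 w (c' l) \<noteq> 0"
      by (rule cpd_duals[OF T' H])
    show "\<exists>\<sigma> \<alpha> \<beta> \<gamma>. \<sigma> permutes {..<R} \<and>
           (\<forall>l<R. a' l = (\<lambda>i. \<alpha> l * a (\<sigma> l) i) \<and> b' l = (\<lambda>i. \<beta> l * b (\<sigma> l) i) \<and>
                  c' l = (\<lambda>i. \<gamma> l * c (\<sigma> l) i))"
    proof (rule cpd_sum_unique[OF _ x x' y', where ?h0.0 = h0 and ?h1.0 = h1 and ?I3.0 = I3])
      show "cpd_sum R a b c = cpd_sum R a' b' c'" using T T' by simp
      show "dotn I3 h0 (c l) \<noteq> 0 \<or> dotn I3 h1 (c l) \<noteq> 0" if "l < R" for l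
        using c that by (auto simp: wdot)
      show "dotn I3 h0 (c' l) \<noteq> 0 \<or> dotn I3 h1 (c' l) \<noteq> 0" if "l < R" for l
        using c' that by (auto simp: wdot)
    qed (use simple_pencil_cpd[OF T X simple] simple_pencil_cpd[OF T' X simple] in auto)
  qed
qed

section \<open>Compression and existence of best approximations\<close>

lemma orthonormal_cols_isometry:
  assumes "orthonormal_cols m n V"
  shows "(\<Sum>i<m. (cmod (\<Sum>a<n. V i a * y a))\<^sup>2) = (\<Sum>a<n. (cmod (y a))\<^sup>2)"
proof -
  have "complex_of_real (\<Sum>i<m. (cmod (\<Sum>a<n. V i a * y a))\<^sup>2) =
      (\<Sum>i<m. (\<Sum>a<n. V i a * y a) * cnj (\<Sum>b<n. V i b * y b))"
    unfolding of_real_sum by (simp only: complex_norm_square)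
  also have "\<dots> = (\<Sum>i<m. \<Sum>a<n. \<Sum>b<n. y a * cnj (y b) * (cnj (V i b) * V i a))"
    by (simp add: sum_product cnj_sum algebra_simps)
  also have "\<dots> = (\<Sum>a<n. \<Sum>b<n. y a * cnj (y b) * (\<Sum>i<m. cnj (V i b) * V i a))"
    by (subst sum.swap, rule sum.cong[OF refl], subst sum.swap) (simp add: sum_distrib_left)
  also have "\<dots> = (\<Sum>a<n. \<Sum>b<n. if b = a then y a * cnj (y a) else 0)"
    using assms by (intro sum.cong refl) (auto simp: orthonormal_cols_def)
  also have "\<dots> = (\<Sum>a<n. y a * cnj (y a))" by simp
  also have "\<dots> = complex_of_real (\<Sum>a<n. (cmod (y a))\<^sup>2)"
    unfolding of_real_sum by (simp only: complex_norm_square)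
  finally show ?thesis unfolding of_real_eq_iff .
qed

text \<open>The squared distance from \<open>x\<close> to its orthogonal projection z = V V^H x is
  nonnegative and equals |x|^2 - |V^H x|^2.\<close>

lemma bessel_inequality:
  assumes "orthonormal_cols m n V"
  shows "(\<Sum>a<n. (cmod (\<Sum>i<m. cnj (V i a) * x i))\<^sup>2) \<le> (\<Sum>i<m. (cmod (x i))\<^sup>2)"
proof -
  define y where "y a = (\<Sum>i<m. cnj (V i a) * x i)" for a
  define z where "z i = (\<Sum>a<n. V i a * y a)" for i
  have "(\<Sum>i<m. cnj (x i) * z i) = (\<Sum>a<n. \<Sum>i<m. cnj (x i) * (V i a * y a))"
    unfolding z_def sum_distrib_left by (rule sum.swap)
  also have "\<dots> = (\<Sum>a<n. y a * cnj (y a))"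
    by (intro sum.cong refl) (simp add: y_def[of _] cnj_sum sum_distrib_left sum_distrib_right algebra_simps)
  also have "\<dots> = complex_of_real (\<Sum>a<n. (cmod (y a))\<^sup>2)"
    unfolding of_real_sum by (simp only: complex_norm_square)
  finally have xz: "(\<Sum>i<m. Re (cnj (x i) * z i)) = (\<Sum>a<n. (cmod (y a))\<^sup>2)"
    by (metis Re_sum Re_complex_of_real)
  have "0 \<le> (\<Sum>i<m. (cmod (x i - z i))\<^sup>2)" by (simp add: sum_nonneg)
  also have "\<dots> = (\<Sum>i<m. (cmod (x i))\<^sup>2 - 2 * Re (cnj (x i) * z i) + (cmod (z i))\<^sup>2)"
    by (intro sum.cong refl) (simp add: cmod_power2, simp add: power2_eq_square algebra_simps)
  also have "\<dots> = (\<Sum>i<m. (cmod (x i))\<^sup>2) - 2 * (\<Sum>i<m. Re (cnj (x i) * z i)) + (\<Sum>i<m. (cmod (z i))\<^sup>2)"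
    by (simp add: sum.distrib sum_subtractf sum_distrib_left)
  also have "(\<Sum>i<m. (cmod (z i))\<^sup>2) = (\<Sum>a<n. (cmod (y a))\<^sup>2)"
    unfolding z_def by (rule orthonormal_cols_isometry[OF assms])
  finally show ?thesis unfolding xz by (simp add: y_def)
qed

text \<open>Bessel's inequality is applied one mode at a time, the swaps bringing the active mode
  innermost; \<open>U\<close> is an isometry on the third mode.\<close>

lemma compress_contraction:
  assumes V: "orthonormal_cols I1 R1 V1" "orthonormal_cols I2 R2 V2" "orthonormal_cols I3 K V3"
    and U: "orthonormal_cols K K U"
  shows "(\<Sum>a<R1. \<Sum>b<R2. \<Sum>k<K. (cmod (mode3_prod K U (compress I1 I2 I3 V1 V2 V3 T) a b k))\<^sup>2) \<le>
    (\<Sum>i<I1. \<Sum>j<I2. \<Sum>k<I3. (cmod (T i j k))\<^sup>2)"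
proof -
  define t1 where "t1 a j l = (\<Sum>i<I1. cnj (V1 i a) * T i j l)" for a j l
  define t2 where "t2 a b l = (\<Sum>j<I2. cnj (V2 j b) * t1 a j l)" for a b l
  have t3: "compress I1 I2 I3 V1 V2 V3 T a b c = (\<Sum>l<I3. cnj (V3 l c) * t2 a b l)" for a b c
  proof -
    have "(\<Sum>l<I3. cnj (V3 l c) * t2 a b l) =
        (\<Sum>l<I3. \<Sum>j<I2. \<Sum>i<I1. cnj (V1 i a) * cnj (V2 j b) * cnj (V3 l c) * T i j l)"
      by (simp add: t1_def t2_def sum_distrib_left algebra_simps)
    also have "\<dots> = (\<Sum>j<I2. \<Sum>l<I3. \<Sum>i<I1. cnj (V1 i a) * cnj (V2 j b) * cnj (V3 l c) * T i j l)"
      by (rule sum.swap)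
    also have "\<dots> = (\<Sum>j<I2. \<Sum>i<I1. \<Sum>l<I3. cnj (V1 i a) * cnj (V2 j b) * cnj (V3 l c) * T i j l)"
      by (intro sum.cong refl sum.swap)
    also have "\<dots> = compress I1 I2 I3 V1 V2 V3 T a b c"
      unfolding compress_def by (rule sum.swap)
    finally show ?thesis by simp
  qed
  have "(\<Sum>a<R1. \<Sum>b<R2. \<Sum>k<K. (cmod (mode3_prod K U (compress I1 I2 I3 V1 V2 V3 T) a b k))\<^sup>2)
      = (\<Sum>a<R1. \<Sum>b<R2. \<Sum>c<K. (cmod (compress I1 I2 I3 V1 V2 V3 T a b c))\<^sup>2)"
    unfolding mode3_prod_def by (intro sum.cong refl orthonormal_cols_isometry[OF U])
  also have "\<dots> \<le> (\<Sum>a<R1. \<Sum>b<R2. \<Sum>l<I3. (cmod (t2 a b l))\<^sup>2)"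
    unfolding t3 by (intro sum_mono bessel_inequality[OF V(3)])
  also have "\<dots> = (\<Sum>a<R1. \<Sum>l<I3. \<Sum>b<R2. (cmod (t2 a b l))\<^sup>2)"
    by (intro sum.cong refl sum.swap)
  also have "\<dots> \<le> (\<Sum>a<R1. \<Sum>l<I3. \<Sum>j<I2. (cmod (t1 a j l))\<^sup>2)"
    unfolding t2_def by (intro sum_mono bessel_inequality[OF V(2)])
  also have "\<dots> = (\<Sum>l<I3. \<Sum>a<R1. \<Sum>j<I2. (cmod (t1 a j l))\<^sup>2)"
    by (rule sum.swap)
  also have "\<dots> = (\<Sum>l<I3. \<Sum>j<I2. \<Sum>a<R1. (cmod (t1 a j l))\<^sup>2)"
    by (intro sum.cong refl sum.swap)
  also have "\<dots> \<le> (\<Sum>l<I3. \<Sum>j<I2. \<Sum>i<I1. (cmod (T i j l))\<^sup>2)"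
    unfolding t1_def by (intro sum_mono bessel_inequality[OF V(1)])
  also have "\<dots> = (\<Sum>j<I2. \<Sum>l<I3. \<Sum>i<I1. (cmod (T i j l))\<^sup>2)" by (rule sum.swap)
  also have "\<dots> = (\<Sum>j<I2. \<Sum>i<I1. \<Sum>l<I3. (cmod (T i j l))\<^sup>2)" by (intro sum.cong refl sum.swap)
  also have "\<dots> = (\<Sum>i<I1. \<Sum>j<I2. \<Sum>l<I3. (cmod (T i j l))\<^sup>2)" by (rule sum.swap)
  finally show ?thesis .
qed

lemma frob_dist_L2_set:
  "frob_dist I1 I2 I3 A B =
     L2_set (\<lambda>(i, j, k). cmod (A i j k - B i j k)) ({..<I1} \<times> {..<I2} \<times> {..<I3})"
  unfolding frob_dist_def L2_set_def
  by (simp add: sum.cartesian_product case_prod_unfold)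

lemma frob_dist_triangle: "frob_dist I1 I2 I3 A C \<le> frob_dist I1 I2 I3 B A + frob_dist I1 I2 I3 B C"
proof -
  let ?S = "{..<I1} \<times> {..<I2} \<times> {..<I3}"
  have "frob_dist I1 I2 I3 A C \<le> L2_set (\<lambda>x. (case x of (i, j, k) \<Rightarrow> cmod (B i j k - A i j k)) +
      (case x of (i, j, k) \<Rightarrow> cmod (B i j k - C i j k))) ?S"
    unfolding frob_dist_L2_set
  proof (intro L2_set_mono)
    fix x assume "x \<in> ?S"
    obtain i j k where x: "x = (i, j, k)" by (cases x)
    show "(case x of (i, j, k) \<Rightarrow> cmod (A i j k - C i j k)) \<le> (case x of (i, j, k) \<Rightarrow> cmod (B i j k - A i j k)) +
        (case x of (i, j, k) \<Rightarrow> cmod (B i j k - C i j k))"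
      using norm_triangle_ineq4[of "B i j k - C i j k" "B i j k - A i j k"] by (simp add: x)
  qed (auto split: prod.splits)
  also have "\<dots> \<le> frob_dist I1 I2 I3 B A + frob_dist I1 I2 I3 B C"
    unfolding frob_dist_L2_set by (rule L2_set_triangle_ineq)
  finally show ?thesis .
qed

lemma entry_le_frob_dist:
  assumes "i < I1" "j < I2" "k < I3"
  shows "cmod (A i j k - B i j k) \<le> frob_dist I1 I2 I3 A B"
  unfolding frob_dist_L2_set
  using member_le_L2_set[of "{..<I1} \<times> {..<I2} \<times> {..<I3}" "(i, j, k)"
      "\<lambda>(i, j, k). cmod (A i j k - B i j k)"] assms by simp

lemma frob_dist_nonneg: "0 \<le> frob_dist I1 I2 I3 A B"
  by (simp add: frob_dist_def sum_nonneg)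

text \<open>For odd \<open>K\<close> the last slice belongs to no pencil and is discarded.\<close>

lemma sum_pairs_le:
  fixes f :: "nat \<Rightarrow> real"
  assumes "\<And>k. f k \<ge> 0"
  shows "(\<Sum>i<K div 2. f (2 * i) + f (2 * i + 1)) \<le> (\<Sum>k<K. f k)"
proof -
  have "(\<Sum>i<n. f (2 * i) + f (2 * i + 1)) = (\<Sum>k<2 * n. f k)" for n
    by (induction n) auto
  also have "(\<Sum>k<2 * (K div 2). f k) \<le> (\<Sum>k<K. f k)"
    using assms by (intro sum_mono2) auto
  finally show ?thesis .
qed

text \<open>The third compression and the unitary matrix merge into U V3^H, whose rows are the
  weights.\<close>

lemma mode3_compress_weighted:
  "mode3_prod K U (compress I1 I2 I3 V1 V2 V3 T) \<alpha> \<beta> k =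
     weighted I3 (\<lambda>l. \<Sum>c<K. U k c * cnj (V3 l c))
       (modal_slice I1 I2 (\<lambda>\<alpha> i. cnj (V1 i \<alpha>)) (\<lambda>\<beta> j. cnj (V2 j \<beta>)) T) \<alpha> \<beta>"
proof -
  have c: "compress I1 I2 I3 V1 V2 V3 T \<alpha> \<beta> c =
      (\<Sum>l<I3. cnj (V3 l c) * modal_slice I1 I2 (\<lambda>\<alpha> i. cnj (V1 i \<alpha>)) (\<lambda>\<beta> j. cnj (V2 j \<beta>)) T l \<alpha> \<beta>)" for c
  proof -
    have "compress I1 I2 I3 V1 V2 V3 T \<alpha> \<beta> c =
        (\<Sum>i<I1. \<Sum>l<I3. \<Sum>j<I2. cnj (V1 i \<alpha>) * cnj (V2 j \<beta>) * cnj (V3 l c) * T i j l)"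
      unfolding compress_def by (intro sum.cong refl sum.swap)
    also have "\<dots> = (\<Sum>l<I3. \<Sum>i<I1. \<Sum>j<I2. cnj (V1 i \<alpha>) * cnj (V2 j \<beta>) * cnj (V3 l c) * T i j l)"
      by (rule sum.swap)
    finally show ?thesis by (simp add: modal_slice_def sum_distrib_left algebra_simps)
  qed
  show ?thesis
    unfolding mode3_prod_def weighted_def c sum_distrib_left sum_distrib_right
    by (subst sum.swap) (simp add: mult.assoc)
qed

section \<open>Locating a simple pencil\<close>

text \<open>Here \<open>p\<close> and \<open>q\<close> come from the compression of
  \<open>W'\<close>, whereas \<open>h0\<close> and \<open>h1\<close> follow the index of the pencil
  and thus depend on \<open>T\<close>. The conclusion covers the whole sublevel set of
  \<open>T0\<close>, so it applies to limits as well as to minimizers.\<close>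

lemma hyps_simple_pencil:
  assumes hyps: "thm27_hyps isreal I1 I2 I3 R M W' W U eps"
  obtains p q T0 where "\<forall>\<alpha> i. p \<alpha> i \<in> Kfield isreal" "\<forall>\<beta> j. q \<beta> j \<in> Kfield isreal"
    "tensor_in (Kfield isreal) I1 I2 I3 M"
    "tensor_in (Kfield isreal) I1 I2 I3 T0" "krank (Kfield isreal) I1 I2 I3 T0 \<le> R"
    "\<forall>T. tensor_in (Kfield isreal) I1 I2 I3 T \<and> frob_dist I1 I2 I3 M T \<le> frob_dist I1 I2 I3 M T0 \<longrightarrow>
      (\<exists>h0 h1. (\<forall>k. h0 k \<in> Kfield isreal) \<and> (\<forall>k. h1 k \<in> Kfield isreal) \<and>
        simple_tensor (Kfield isreal) R 2 (pencil (weighted I3 h0 (modal_slice I1 I2 p q T))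
          (weighted I3 h1 (modal_slice I1 I2 p q T))))"
proof -
  define F where "F = Kfield isreal"
  define K where "K = min (span_dim F I3 (mode3_fibers I1 I2 I3 M)) R"
  define S where "S = mode3_prod K U W"
  define \<epsilon> where "\<epsilon> = sqrt (\<Sum>i<K div 2. (eps i)\<^sup>2)"
  have M: "tensor_in F I1 I2 I3 M"
    and ml: "mlrank F I1 I2 I3 W' = (R, R, K)"
    and oc: "orth_compression F I1 I2 I3 W' W" and U: "unitary_K F K U"
    and ball: "\<forall>i < K div 2. eps i \<ge> 0 \<and> ball_simple F R (tslice S (2*i)) (tslice S (2*i+1)) (eps i)"
    and ex: "\<exists>T. tensor_in F I1 I2 I3 T \<and> krank F I1 I2 I3 T = R \<and>
              frob_dist I1 I2 I3 M T < \<epsilon> - frob_dist I1 I2 I3 M W'"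
    using hyps unfolding thm27_hyps_def Let_def F_def[symmetric] K_def[symmetric] S_def[symmetric]
      \<epsilon>_def[symmetric] by blast+
  obtain T0 where T0: "tensor_in F I1 I2 I3 T0" "krank F I1 I2 I3 T0 = R"
    "frob_dist I1 I2 I3 M T0 < \<epsilon> - frob_dist I1 I2 I3 M W'" using ex by blast
  from ml have sd: "span_dim F I1 (mode1_fibers I1 I2 I3 W') = R"
    "span_dim F I2 (mode2_fibers I1 I2 I3 W') = R" "span_dim F I3 (mode3_fibers I1 I2 I3 W') = K"
    by (auto simp: mlrank_def)
  obtain V1 V2 V3 where V: "onb_cols F I1 R V1 (mode1_fibers I1 I2 I3 W')"
    "onb_cols F I2 R V2 (mode2_fibers I1 I2 I3 W')" "onb_cols F I3 K V3 (mode3_fibers I1 I2 I3 W')"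
    and W: "W = compress I1 I2 I3 V1 V2 V3 W'"
    using oc unfolding orth_compression_def sd by blast
  have VF: "mat_in F I1 R V1" "mat_in F I2 R V2" "mat_in F I3 K V3" "mat_in F K K U"
    and Vo: "orthonormal_cols I1 R V1" "orthonormal_cols I2 R V2" "orthonormal_cols I3 K V3"
      "orthonormal_cols K K U"
    using V U by (auto simp: onb_cols_def unitary_K_def)
  have inF: "A i j \<in> Kfield isreal" if "mat_in F m n A" for A m n i j
    using that unfolding mat_in_def F_def by (metis Kfield_closed(1))
  define p where "p = (\<lambda>\<alpha> i. cnj (V1 i \<alpha>))"
  define q where "q = (\<lambda>\<beta> j. cnj (V2 j \<beta>))"
  define h where "h = (\<lambda>k l. \<Sum>c<K. U k c * cnj (V3 l c))"
  have pF: "p \<alpha> i \<in> Kfield isreal" for \<alpha> i using inF[OF VF(1)] by (simp add: p_def)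
  have qF: "q \<beta> j \<in> Kfield isreal" for \<beta> j using inF[OF VF(2)] by (simp add: q_def)
  have hF: "h k l \<in> Kfield isreal" for k l using inF[OF VF(3)] inF[OF VF(4)] by (auto simp: h_def)
  have main: "\<exists>h0 h1. (\<forall>k. h0 k \<in> F) \<and> (\<forall>k. h1 k \<in> F) \<and>
      simple_tensor F R 2 (pencil (weighted I3 h0 (modal_slice I1 I2 p q T))
        (weighted I3 h1 (modal_slice I1 I2 p q T)))"
    if T: "tensor_in F I1 I2 I3 T" and d: "frob_dist I1 I2 I3 M T \<le> frob_dist I1 I2 I3 M T0" for T
  proof -
    define Y where "Y = mode3_prod K U (compress I1 I2 I3 V1 V2 V3 T)"
    have Yw: "Y \<alpha> \<beta> k = weighted I3 (h k) (modal_slice I1 I2 p q T) \<alpha> \<beta>" for \<alpha> \<beta> k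
      unfolding Y_def mode3_compress_weighted h_def p_def q_def ..
    have YS: "Y a b k - S a b k =
        mode3_prod K U (compress I1 I2 I3 V1 V2 V3 (\<lambda>i j k. T i j k - W' i j k)) a b k" for a b k
      by (simp add: Y_def S_def W mode3_prod_def compress_def right_diff_distrib sum_subtractf)
    define D where "D = (\<lambda>i. \<Sum>a<R. \<Sum>b<R. (cmod (Y a b (2*i) - S a b (2*i)))\<^sup>2 +
        (cmod (Y a b (2*i+1) - S a b (2*i+1)))\<^sup>2)"
    have "(\<Sum>i<K div 2. D i) =
        (\<Sum>a<R. \<Sum>b<R. \<Sum>i<K div 2. (cmod (Y a b (2*i) - S a b (2*i)))\<^sup>2 +
        (cmod (Y a b (2*i+1) - S a b (2*i+1)))\<^sup>2)"
      unfolding D_def by (subst sum.swap, rule sum.cong[OF refl], rule sum.swap)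
    also have "\<dots> \<le> (\<Sum>a<R. \<Sum>b<R. \<Sum>k<K. (cmod (Y a b k - S a b k))\<^sup>2)"
      by (intro sum_mono sum_pairs_le) simp
    also have "\<dots> \<le> (\<Sum>i<I1. \<Sum>j<I2. \<Sum>k<I3. (cmod (T i j k - W' i j k))\<^sup>2)"
      unfolding YS by (rule compress_contraction[OF Vo])
    also have "\<dots> = (frob_dist I1 I2 I3 T W')\<^sup>2"
      unfolding frob_dist_def by (subst real_sqrt_pow2) (auto intro!: sum_nonneg)
    \<comment> \<open>The triangle inequality through \<open>M\<close> meets the bound assumed for
      \<open>T0\<close>, since \<open>T\<close> is no farther from \<open>M\<close> than
      \<open>T0\<close>.\<close>
    also have "\<dots> < \<epsilon>\<^sup>2"
    proof (rule power_strict_mono)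
      show "frob_dist I1 I2 I3 T W' < \<epsilon>"
        using frob_dist_triangle[of I1 I2 I3 T W' M] d T0(3) by simp
    qed (simp_all add: frob_dist_nonneg)
    also have "\<dots> = (\<Sum>i<K div 2. (eps i)\<^sup>2)" by (simp add: \<epsilon>_def sum_nonneg)
    finally have "(\<Sum>i<K div 2. D i) < (\<Sum>i<K div 2. (eps i)\<^sup>2)" .
    then obtain i where i: "i < K div 2" "D i < (eps i)\<^sup>2"
      by (meson lessThan_iff not_le sum_mono)
    have "sqrt (D i) < eps i" using i ball by (metis real_sqrt_less_iff real_sqrt_unique)
    have TF: "T i j k \<in> Kfield isreal" for i j k
      using T unfolding tensor_in_def F_def by (metis Kfield_closed(1))
    \<comment> \<open>\<open>ball_simple\<close> speaks only of matrices vanishing outside the R x R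
      block; \<open>Y\<close> inherits this from the zero columns of \<open>V1\<close> and
      \<open>V2\<close> beyond \<open>R\<close>.\<close>
    have Ymat: "mat_in F R R (tslice Y k)" for k
    proof -
      have "Y a b k \<in> F" for a b
        unfolding Yw weighted_def modal_slice_def F_def using hF pF qF TF by auto
      moreover have "Y a b k = 0" if "\<not> (a < R \<and> b < R)" for a b
      proof -
        have "p a i * q b j = 0" for i j
          using VF(1,2) that unfolding mat_in_def p_def q_def by (auto simp: not_less)
        then show ?thesis
          unfolding Yw weighted_def modal_slice_def
          by (simp only: mult_zero_left mult_zero_right sum.neutral_const)
      qed
      ultimately show ?thesis by (auto simp: mat_in_def tslice_def)
    qed
    have "ball_simple F R (tslice S (2*i)) (tslice S (2*i+1)) (eps i)" using ball i by blast
    then have "simple_tensor F R 2 (pencil (tslice Y (2*i)) (tslice Y (2*i+1)))"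
      using Ymat \<open>sqrt (D i) < eps i\<close> unfolding ball_simple_def D_def tslice_def by blast
    moreover have "tslice Y k = weighted I3 (h k) (modal_slice I1 I2 p q T)" for k
      by (intro ext) (simp add: tslice_def Yw)
    ultimately show ?thesis
      using hF unfolding F_def by (intro exI[of _ "h (2*i)"] exI[of _ "h (2*i+1)"]) simp
  qed
  show ?thesis
    by (rule that[of p q T0]) (use pF qF M T0 main in \<open>auto simp: F_def\<close>)
qed

section \<open>Compactness and attained minima\<close>

text \<open>Tychonoff's theorem for one function argument; a curried tensor uses it three
  times.\<close>

lemma compact_box_fun:
  fixes S :: "'i \<Rightarrow> 'b::topological_space set"
  assumes "\<And>i. compact (S i)"
  shows "compact {f. \<forall>i. f i \<in> S i}"
proof -
  have "compactin (product_topology (\<lambda>i::'i. euclidean :: 'b topology) UNIV) (PiE UNIV S)"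
    using assms by (subst compactin_PiE) simp
  moreover have "PiE UNIV S = {f. \<forall>i. f i \<in> S i}" by (auto simp: PiE_def Pi_def)
  ultimately show ?thesis by (simp add: euclidean_product_topology)
qed

lemma continuous_on_frob_dist: "continuous_on UNIV (\<lambda>T. frob_dist I1 I2 I3 M T)"
  "continuous_on UNIV (\<lambda>M. frob_dist I1 I2 I3 M T)"
  unfolding frob_dist_def by (intro continuous_intros continuous_on_tensor_entry)+

lemma closed_tensor_in: "closed {T. tensor_in (Kfield F) I1 I2 I3 T}"
proof -
  have "closed (Kfield F)" by (simp add: Kfield_def closed_complex_Reals)
  then have "closed (if i < I1 \<and> j < I2 \<and> k < I3 then Kfield F else {0})" for i j k by simp
  then have "closed {T. T i j k \<in> (if i < I1 \<and> j < I2 \<and> k < I3 then Kfield F else {0})}" for i j k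
    by (rule closed_vimage[OF _ continuous_on_tensor_entry[of i j k], unfolded vimage_def])
  then have "closed {T. \<forall>i j k. T i j k \<in> (if i < I1 \<and> j < I2 \<and> k < I3 then Kfield F else {0})}"
    by (intro closed_Collect_all)
  moreover have "{T. \<forall>i j k. T i j k \<in> (if i < I1 \<and> j < I2 \<and> k < I3 then Kfield F else {0})} =
      {T. tensor_in (Kfield F) I1 I2 I3 T}"
    by (auto simp: tensor_in_def split: if_splits)
  ultimately show ?thesis by simp
qed

text \<open>Low rank tensors are assumed to contain their limits only within the sublevel set of
  \<open>T0\<close>. The closure cut with that sublevel set is compact, and the minimizer found
  there has low rank by this assumption.\<close>

lemma best_approx_exists:
  assumes M: "tensor_in (Kfield F) I1 I2 I3 M"
    and T0: "tensor_in (Kfield F) I1 I2 I3 T0" "krank (Kfield F) I1 I2 I3 T0 \<le> R"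
    and closed: "\<And>T. T \<in> closure {T. tensor_in (Kfield F) I1 I2 I3 T \<and> krank (Kfield F) I1 I2 I3 T \<le> R} \<Longrightarrow>
      tensor_in (Kfield F) I1 I2 I3 T \<Longrightarrow>
      frob_dist I1 I2 I3 M T \<le> frob_dist I1 I2 I3 M T0 \<Longrightarrow> krank (Kfield F) I1 I2 I3 T \<le> R"
  shows "\<exists>T. best_approx (Kfield F) I1 I2 I3 R M T"
proof -
  let ?X = "{T. tensor_in (Kfield F) I1 I2 I3 T \<and> krank (Kfield F) I1 I2 I3 T \<le> R}"
  let ?d = "frob_dist I1 I2 I3 M"
  define C where "C = closure ?X \<inter> {T. ?d T \<le> ?d T0}"
  \<comment> \<open>The box is valid outside the index range too: there both tensors vanish, and the
    radius is nonnegative.\<close>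
  define B where "B = {T. \<forall>i. T i \<in> {f. \<forall>j. f j \<in> {g. \<forall>k. g k \<in> cball (M i j k) (?d T0)}}}"
  have "compact B" unfolding B_def by (intro compact_box_fun compact_cball)
  have Xin: "closure ?X \<subseteq> {T. tensor_in (Kfield F) I1 I2 I3 T}"
    by (rule closure_minimal[OF _ closed_tensor_in]) auto
  have "C \<subseteq> B"
  proof
    fix T assume "T \<in> C"
    then have T: "tensor_in (Kfield F) I1 I2 I3 T" "?d T \<le> ?d T0" using Xin by (auto simp: C_def)
    have "cmod (M i j k - T i j k) \<le> ?d T0" for i j k
    proof (cases "i < I1 \<and> j < I2 \<and> k < I3")
      case True
      then show ?thesis using entry_le_frob_dist[of i I1 j I2 k I3 M T] T(2) by simp
    next
      case False
      then have "M i j k = 0" "T i j k = 0" using M T(1) unfolding tensor_in_def by metis+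
      then show ?thesis by (simp add: frob_dist_nonneg)
    qed
    then show "T \<in> B" by (simp add: B_def dist_norm)
  qed
  moreover have "closed C" unfolding C_def
    by (intro closed_Int closed_closure closed_Collect_le continuous_on_frob_dist continuous_on_const)
  ultimately have "compact C" using \<open>compact B\<close> by (metis compact_Int_closed inf.absorb_iff2)
  moreover have "T0 \<in> C" using T0 closure_subset[of ?X] by (auto simp: C_def)
  ultimately obtain T where T: "T \<in> C" "\<forall>T'\<in>C. ?d T \<le> ?d T'"
    using continuous_attains_inf[of C ?d] continuous_on_subset[OF continuous_on_frob_dist(1)] by blast
  have Tin: "tensor_in (Kfield F) I1 I2 I3 T" using T(1) Xin by (auto simp: C_def)
  have "?d T \<le> ?d T'" if "tensor_in (Kfield F) I1 I2 I3 T'" "krank (Kfield F) I1 I2 I3 T' \<le> R" for T'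
  proof (cases "?d T' \<le> ?d T0")
    case True
    then have "T' \<in> C" using that closure_subset[of ?X] by (auto simp: C_def)
    then show ?thesis using T(2) by blast
  next
    case False
    then show ?thesis using T(2) \<open>T0 \<in> C\<close> by fastforce
  qed
  then have "best_approx (Kfield F) I1 I2 I3 R M T"
    using Tin closed[OF _ Tin] T(1) by (auto simp: best_approx_def C_def)
  then show ?thesis by blast
qed

text \<open>The set is first enlarged to sums with arbitrary complex factors, where the identities
  on the closure are available; the simple pencil then gives back factors over K.\<close>

lemma closure_krank_le:
  assumes cl: "T \<in> closure {T. tensor_in (Kfield F) I1 I2 I3 T \<and> krank (Kfield F) I1 I2 I3 T \<le> R}"
    and T: "tensor_in (Kfield F) I1 I2 I3 T"
    and pq: "\<forall>\<alpha> i. p \<alpha> i \<in> Kfield F" "\<forall>\<beta> j. q \<beta> j \<in> Kfield F"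
    and h: "\<forall>k. h0 k \<in> Kfield F" "\<forall>k. h1 k \<in> Kfield F"
    and simple: "simple_tensor (Kfield F) R 2 (pencil (weighted I3 h0 (modal_slice I1 I2 p q T))
          (weighted I3 h1 (modal_slice I1 I2 p q T)))"
  shows "krank (Kfield F) I1 I2 I3 T \<le> R"
proof -
  have "{T. tensor_in (Kfield F) I1 I2 I3 T \<and> krank (Kfield F) I1 I2 I3 T \<le> R} \<subseteq>
      {T. \<exists>a b c. T = cpd_sum R a b c}"
    by (auto elim!: krank_le_imp_cpd_sum)
  then have cl': "T \<in> closure {T. \<exists>a b c. T = cpd_sum R a b c}"
    using cl closure_mono by blast
  show ?thesis
  proof (rule decomposition_of_commuting_slices[OF T _ _ _ _ refl simple])
    fix w H i j k
    assume H: "right_inv R H (weighted I3 w (modal_slice I1 I2 p q T))"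
    show "mm R (modal_slice I1 I2 p q T j) (mm R H (modal_slice I1 I2 p q T k)) =
         mm R (modal_slice I1 I2 p q T k) (mm R H (modal_slice I1 I2 p q T j))"
      by (rule closure_cpd_identities[OF cl' H])
    show "T i j k = mm R (weighted I3 w (modal_left I2 q T)) (mm R H (mm R (modal_slice I1 I2 p q T k)
           (mm R H (weighted I3 w (modal_right I1 p T))))) i j"
      by (rule closure_cpd_identities[OF cl' H])
  next
    fix a b c
    assume "T = cpd_sum R a b c" "\<And>l. l < R \<Longrightarrow> vec_in (Kfield F) I1 (a l)"
      "\<And>l. l < R \<Longrightarrow> vec_in (Kfield F) I2 (b l)" "\<And>l. l < R \<Longrightarrow> vec_in (Kfield F) I3 (c l)"
    then show ?thesis using krank_cpd_sum_le by metis
  qed (use pq h in auto)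
qed

section \<open>Tensors with several nearest points\<close>

text \<open>A bounded piece of \<open>A\<close> has infinitely many disjoint translates, by v / (m +
  1), of equal measure inside one ball, so its measure is 0.\<close>

lemma emeasure_zero_of_disjoint_translates:
  fixes A :: "'a::euclidean_space set"
  assumes A: "A \<in> sets borel" and disj: "\<And>y t. y \<in> A \<Longrightarrow> t > 0 \<Longrightarrow> y + t *\<^sub>R v \<notin> A"
  shows "emeasure lborel A = 0"
proof -
  have null: "A \<inter> cball 0 (real n) \<in> null_sets lborel" for n
  proof -
    define B where "B = A \<inter> cball 0 (real n)"
    have B: "B \<in> sets borel" using A by (simp add: B_def)
    define s where "s m = inverse (real (Suc m))" for m
    define C where "C m = (+) (- s m *\<^sub>R v) -` B" for m
    have Cs: "C m \<in> sets borel" for m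
      unfolding C_def using measurable_sets[OF _ B, of "(+) (- s m *\<^sub>R v)" borel] by simp
    have C_emeasure: "emeasure lborel (C m) = emeasure lborel B" for m
    proof -
      have "emeasure lborel B = emeasure (distr lborel borel ((+) (- s m *\<^sub>R v))) B"
        by (simp only: lborel_distr_plus)
      also have "\<dots> = emeasure lborel (C m)"
        unfolding C_def using B by (subst emeasure_distr) simp_all
      finally show ?thesis by simp
    qed
    have no: False if "z \<in> C m" "z \<in> C m'" "m < m'" for z m m'
    proof -
      have "s m' < s m" using that(3) by (simp add: s_def)
      moreover have "(z - s m *\<^sub>R v) + (s m - s m') *\<^sub>R v = z - s m' *\<^sub>R v"
        by (simp add: algebra_simps)
      moreover have "z - s m *\<^sub>R v \<in> A" "z - s m' *\<^sub>R v \<in> A"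
        using that(1,2) by (simp_all add: C_def B_def)
      ultimately show False using disj[of "z - s m *\<^sub>R v" "s m - s m'"] by (metis diff_gt_0_iff_gt)
    qed
    have disjC: "disjoint_family_on C I" for I
      unfolding disjoint_family_on_def
    proof (intro ballI impI)
      fix m m' :: nat assume "m \<noteq> m'"
      then show "C m \<inter> C m' = {}"
        using no[of _ m m'] no[of _ m' m] by (cases m m' rule: linorder_cases) auto
    qed
    have sub: "C m \<subseteq> cball 0 (real n + norm v)" for m
    proof
      fix z assume "z \<in> C m"
      then have "norm (z - s m *\<^sub>R v) \<le> real n" by (simp add: C_def B_def)
      moreover have "norm (s m *\<^sub>R v) \<le> norm v"
        using mult_right_mono[of "s m" 1 "norm v"] by (simp add: s_def inverse_le_1_iff)
      moreover have "norm z \<le> norm (z - s m *\<^sub>R v) + norm (s m *\<^sub>R v)"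
        by (metis diff_add_cancel norm_triangle_ineq)
      ultimately show "z \<in> cball 0 (real n + norm v)" by simp
    qed
    define r where "r = measure lborel B"
    define L where "L = measure lborel (cball (0::'a) (real n + norm v))"
    have "bounded B" unfolding B_def by (simp add: bounded_Int)
    then have r: "emeasure lborel B = ennreal r"
      unfolding r_def using emeasure_bounded_finite[of B] by (intro emeasure_eq_ennreal_measure) auto
    have L: "emeasure lborel (cball (0::'a) (real n + norm v)) = ennreal L"
      unfolding L_def using emeasure_lborel_cball_finite[of "0::'a" "real n + norm v"]
      by (intro emeasure_eq_ennreal_measure) auto
    have "real k * r \<le> L" for k
    proof -
      have "ennreal (real k * r) = (\<Sum>m<k. emeasure lborel (C m))"
        by (simp add: C_emeasure r ennreal_mult'' ennreal_of_nat_eq_real_of_nat r_def)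
      also have "\<dots> = emeasure lborel (\<Union>m<k. C m)"
        using Cs by (intro sum_emeasure disjC) auto
      also have "\<dots> \<le> ennreal L"
        unfolding L[symmetric] using sub by (intro emeasure_mono) auto
      finally show ?thesis by (simp add: L_def)
    qed
    then have "\<not> r > 0" using reals_Archimedean3[of r] by (meson not_le)
    moreover have "r \<ge> 0" by (simp add: r_def)
    ultimately have "r = 0" by simp
    then show ?thesis using r B by (auto simp: B_def[symmetric])
  qed
  have "A = (\<Union>n. A \<inter> cball 0 (real n))"
    by (auto simp: real_arch_simple)
  also have "\<dots> \<in> null_sets lborel" using null by (rule null_sets_UN)
  finally show ?thesis by auto
qed

text \<open>Distances are squared because a shift of one entry of \<open>M\<close> then changes them
  by a term affine in \<open>T\<close>.\<close>

definition inf_sq_dist :: "nat \<Rightarrow> nat \<Rightarrow> nat \<Rightarrow> tensor set \<Rightarrow> tensor \<Rightarrow> real" where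
  "inf_sq_dist I1 I2 I3 Y M = (INF T\<in>Y. (frob_dist I1 I2 I3 M T)\<^sup>2)"

lemma inf_sq_dist_bdd: "bdd_below ((\<lambda>T. (frob_dist I1 I2 I3 M T)\<^sup>2) ` Y)"
  by (rule bdd_belowI[of _ 0]) auto

lemma inf_sq_dist_le: "T \<in> Y \<Longrightarrow> inf_sq_dist I1 I2 I3 Y M \<le> (frob_dist I1 I2 I3 M T)\<^sup>2"
  unfolding inf_sq_dist_def by (rule cINF_lower[OF inf_sq_dist_bdd])

lemma inf_sq_dist_less:
  "Y \<noteq> {} \<Longrightarrow> inf_sq_dist I1 I2 I3 Y M < c \<longleftrightarrow> (\<exists>T\<in>Y. (frob_dist I1 I2 I3 M T)\<^sup>2 < c)"
  unfolding inf_sq_dist_def by (rule cINF_less_iff[OF _ inf_sq_dist_bdd])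

lemma inf_sq_dist_attained:
  assumes "T \<in> Y" "\<And>T'. T' \<in> Y \<Longrightarrow> frob_dist I1 I2 I3 M T \<le> frob_dist I1 I2 I3 M T'"
  shows "inf_sq_dist I1 I2 I3 Y M = (frob_dist I1 I2 I3 M T)\<^sup>2"
proof (rule antisym)
  show "inf_sq_dist I1 I2 I3 Y M \<le> (frob_dist I1 I2 I3 M T)\<^sup>2" by (rule inf_sq_dist_le[OF assms(1)])
  show "(frob_dist I1 I2 I3 M T)\<^sup>2 \<le> inf_sq_dist I1 I2 I3 Y M"
    unfolding inf_sq_dist_def using assms
    by (intro cINF_greatest) (auto intro!: power_mono simp: frob_dist_nonneg)
qed

text \<open>The strict sublevel set of the infimum is a union of open ones, hence open even for
  uncountable \<open>Y\<close>.\<close>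

lemma borel_measurable_inf_sq_dist:
  assumes "Y \<noteq> {}"
  shows "inf_sq_dist I1 I2 I3 Y \<in> borel_measurable borel"
proof (rule borel_measurableI_less)
  fix c
  have "{M. (frob_dist I1 I2 I3 M T)\<^sup>2 < c} \<in> {S. open S}" for T
    by (simp, intro open_Collect_less continuous_intros continuous_on_frob_dist)
  then have "open (\<Union>T\<in>Y. {M. (frob_dist I1 I2 I3 M T)\<^sup>2 < c})" by auto
  moreover have "{M \<in> space borel. inf_sq_dist I1 I2 I3 Y M < c} = (\<Union>T\<in>Y. {M. (frob_dist I1 I2 I3 M T)\<^sup>2 < c})"
    using inf_sq_dist_less[OF assms] by auto
  ultimately show "{M \<in> space borel. inf_sq_dist I1 I2 I3 Y M < c} \<in> sets borel" by simp
qed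

lemma sq_dist_shift:
  assumes e: "i < I1" "j < I2" "k < I3"
    and M': "\<And>i' j' k'. M' i' j' k' = M i' j' k' + (if (i', j', k') = (i, j, k) then of_real t * u else 0)"
  shows "(frob_dist I1 I2 I3 M' T)\<^sup>2 = (frob_dist I1 I2 I3 M T)\<^sup>2 +
    2 * t * Re (cnj u * (M i j k - T i j k)) + t\<^sup>2 * (cmod u)\<^sup>2"
proof -
  define S where "S = {..<I1} \<times> {..<I2} \<times> {..<I3}"
  have sq: "(frob_dist I1 I2 I3 M T)\<^sup>2 = (\<Sum>(i', j', k')\<in>S. (cmod (M i' j' k' - T i' j' k'))\<^sup>2)" for M
    unfolding frob_dist_def S_def
    by (subst real_sqrt_pow2) (auto intro!: sum_nonneg simp: sum.cartesian_product)
  have fin: "finite S" and mem: "(i, j, k) \<in> S" using e by (auto simp: S_def)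
  have "(frob_dist I1 I2 I3 M' T)\<^sup>2 - (frob_dist I1 I2 I3 M T)\<^sup>2 =
      (\<Sum>(i', j', k')\<in>S. (cmod (M' i' j' k' - T i' j' k'))\<^sup>2 - (cmod (M i' j' k' - T i' j' k'))\<^sup>2)"
    unfolding sq by (simp add: sum_subtractf[symmetric] case_prod_unfold)
  also have "\<dots> = (\<Sum>x\<in>S. if x = (i, j, k) then
      (cmod (M i j k + of_real t * u - T i j k))\<^sup>2 - (cmod (M i j k - T i j k))\<^sup>2 else 0)"
    by (intro sum.cong refl) (auto simp: M' split: prod.splits)
  also have "\<dots> = (cmod (M i j k + of_real t * u - T i j k))\<^sup>2 - (cmod (M i j k - T i j k))\<^sup>2"
    using fin mem by simp
  also have "\<dots> = 2 * t * Re (cnj u * (M i j k - T i j k)) + t\<^sup>2 * (cmod u)\<^sup>2"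
    by (simp add: cmod_power2, simp add: power2_eq_square algebra_simps)
  finally show ?thesis by simp
qed

text \<open>The tensors with nearest points of \<open>X\<close> on both sides of the gap between \<open>s\<close> and \<open>r\<close>,
  phrased with infima so that neither attainment nor closedness of \<open>X\<close> is needed for measurability.\<close>

definition split_nearest :: "nat \<Rightarrow> nat \<Rightarrow> nat \<Rightarrow> tensor set \<Rightarrow> nat \<times> nat \<times> nat \<Rightarrow> complex \<Rightarrow> real \<Rightarrow> real \<Rightarrow> tensor set" where
  "split_nearest I1 I2 I3 X = (\<lambda>(i, j, k) u s r.
     {M. inf_sq_dist I1 I2 I3 {T \<in> X. Re (cnj u * T i j k) \<le> s} M = inf_sq_dist I1 I2 I3 X M \<and>
         inf_sq_dist I1 I2 I3 {T \<in> X. r \<le> Re (cnj u * T i j k)} M = inf_sq_dist I1 I2 I3 X M})"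

text \<open>The metric projection is monotone along lines: moving \<open>M\<close> in the direction \<open>u\<close> at entry
  \<open>(i, j, k)\<close> cannot move nearest points backwards, so each such line meets the set at most once.\<close>

lemma split_nearest_line:
  assumes e: "i < I1" "j < I2" "k < I3"
    and M': "\<And>i' j' k'. M' i' j' k' = M i' j' k' + (if (i', j', k') = (i, j, k) then of_real t * u else 0)"
    and t: "t > 0" and sr: "s < r"
    and ne: "{T \<in> X. Re (cnj u * T i j k) \<le> s} \<noteq> {}" "{T \<in> X. r \<le> Re (cnj u * T i j k)} \<noteq> {}"
    and M_in: "M \<in> split_nearest I1 I2 I3 X (i, j, k) u s r"
  shows "M' \<notin> split_nearest I1 I2 I3 X (i, j, k) u s r"
proof
  assume M'_in: "M' \<in> split_nearest I1 I2 I3 X (i, j, k) u s r"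
  let ?D = "inf_sq_dist I1 I2 I3"
  let ?d = "\<lambda>M T. (frob_dist I1 I2 I3 M T)\<^sup>2"
  \<comment> \<open>Each of the two near-minimizers is granted slack \<delta>. Adding their
    inequalities leaves only the shift terms, which are at least 2 t (r - s) = 2 \<delta>, the total
    slack.\<close>
  define \<delta> where "\<delta> = t * (r - s)"
  have \<delta>: "\<delta> > 0" using t sr by (simp add: \<delta>_def)
  have "?D {T \<in> X. r \<le> Re (cnj u * T i j k)} M < ?D X M + \<delta>"
    using M_in \<delta> by (simp add: split_nearest_def)
  then obtain T where T: "T \<in> X" "r \<le> Re (cnj u * T i j k)" "?d M T < ?D X M + \<delta>"
    unfolding inf_sq_dist_less[OF ne(2)] by blast
  have "?D {T \<in> X. Re (cnj u * T i j k) \<le> s} M' < ?D X M' + \<delta>"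
    using M'_in \<delta> by (simp add: split_nearest_def)
  then obtain T' where T': "T' \<in> X" "Re (cnj u * T' i j k) \<le> s" "?d M' T' < ?D X M' + \<delta>"
    unfolding inf_sq_dist_less[OF ne(1)] by blast
  have "?D X M \<le> ?d M T'" "?D X M' \<le> ?d M' T"
    using T(1) T'(1) by (simp_all add: inf_sq_dist_le)
  then have "?d M T + ?d M' T' < ?d M T' + ?d M' T + 2 * \<delta>" using T(3) T'(3) by simp
  then have "2 * t * (Re (cnj u * T i j k) - Re (cnj u * T' i j k)) < 2 * \<delta>"
    unfolding sq_dist_shift[OF e M'] by (simp add: algebra_simps)
  then have "t * (Re (cnj u * T i j k) - Re (cnj u * T' i j k)) < t * (r - s)"
    by (simp add: \<delta>_def algebra_simps)
  then show False using t T(2) T'(2) by simp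
qed

lemma split_nearest_borel:
  assumes "X \<noteq> {}" "{T \<in> X. Re (cnj u * T i j k) \<le> s} \<noteq> {}" "{T \<in> X. r \<le> Re (cnj u * T i j k)} \<noteq> {}"
  shows "split_nearest I1 I2 I3 X (i, j, k) u s r \<in> sets borel"
proof -
  let ?D = "inf_sq_dist I1 I2 I3"
  let ?lo = "{T \<in> X. Re (cnj u * T i j k) \<le> s}" and ?hi = "{T \<in> X. r \<le> Re (cnj u * T i j k)}"
  have eq: "{M. f M = g M} \<in> sets borel"
    if "f \<in> borel_measurable borel" "g \<in> borel_measurable borel" for f g :: "tensor \<Rightarrow> real"
  proof -
    note that [measurable]
    have "{M \<in> space borel. f M = g M} \<in> sets borel" by measurable
    then show ?thesis by simp
  qed
  have "{M. ?D ?lo M = ?D X M} \<inter> {M. ?D ?hi M = ?D X M} \<in> sets borel"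
    by (intro sets.Int eq borel_measurable_inf_sq_dist assms)
  then show ?thesis unfolding split_nearest_def case_prod_conv Collect_conj_eq .
qed

section \<open>Fubini and a countable covering\<close>

text \<open>One embedding serves both fields: \<open>complex_of_real\<close> on the line, the
  identity on the complex plane. With these it is the map inside \<open>tensor_null\<close>.\<close>

definition to_tensor :: "nat \<Rightarrow> nat \<Rightarrow> nat \<Rightarrow> ('a \<Rightarrow> complex) \<Rightarrow> (nat \<times> nat \<times> nat \<Rightarrow> 'a) \<Rightarrow> tensor" where
  "to_tensor I1 I2 I3 emb f = (\<lambda>i j k. if i < I1 \<and> j < I2 \<and> k < I3 then emb (f (i, j, k)) else 0)"

lemma to_tensor_measurable:
  fixes emb :: "'a::euclidean_space \<Rightarrow> complex"
  assumes "emb \<in> borel_measurable borel"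
  shows "to_tensor I1 I2 I3 emb \<in>
    borel_measurable (PiM ({..<I1} \<times> {..<I2} \<times> {..<I3}) (\<lambda>_. (lborel :: 'a measure)))"
proof (intro measurable_coordinatewise_then_product)
  fix i j k
  show "(\<lambda>f. to_tensor I1 I2 I3 emb f i j k) \<in>
      borel_measurable (PiM ({..<I1} \<times> {..<I2} \<times> {..<I3}) (\<lambda>_. (lborel :: 'a measure)))"
  proof (cases "i < I1 \<and> j < I2 \<and> k < I3")
    case True
    then have "(\<lambda>f. f (i, j, k)) \<in>
        PiM ({..<I1} \<times> {..<I2} \<times> {..<I3}) (\<lambda>_. (lborel :: 'a measure)) \<rightarrow>\<^sub>M lborel"
      by (intro measurable_component_singleton) auto
    moreover have "emb \<in> lborel \<rightarrow>\<^sub>M borel" using assms by simp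
    ultimately have "(\<lambda>f. emb (f (i, j, k))) \<in>
        borel_measurable (PiM ({..<I1} \<times> {..<I2} \<times> {..<I3}) (\<lambda>_. (lborel :: 'a measure)))"
      by (rule measurable_compose)
    then show ?thesis using True by (simp add: to_tensor_def)
  next
    case False
    then have "(\<lambda>f. to_tensor I1 I2 I3 emb f i j k) = (\<lambda>_. 0)" by (auto simp: to_tensor_def fun_eq_iff)
    then show ?thesis by simp
  qed
qed

text \<open>Fubini splits off the coordinate (i, j, k). With the others fixed,
  \<open>split_nearest_line\<close> makes the section disjoint from its positive translates along
  \<open>v\<close>, hence null.\<close>

lemma split_nearest_null:
  fixes emb :: "'a::euclidean_space \<Rightarrow> complex"
  assumes emb: "bounded_linear emb"
    and e: "i < I1" "j < I2" "k < I3" and sr: "s < r"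
    and ne: "{T \<in> X. Re (cnj (emb v) * T i j k) \<le> s} \<noteq> {}" "{T \<in> X. r \<le> Re (cnj (emb v) * T i j k)} \<noteq> {}"
  defines "P \<equiv> PiM ({..<I1} \<times> {..<I2} \<times> {..<I3}) (\<lambda>_. (lborel :: 'a measure))"
  shows "{f \<in> space P. to_tensor I1 I2 I3 emb f \<in> split_nearest I1 I2 I3 X (i, j, k) (emb v) s r} \<in> null_sets P"
proof -
  interpret emb: bounded_linear emb by (rule emb)
  interpret product_sigma_finite "\<lambda>_ :: nat \<times> nat \<times> nat. (lborel :: 'a measure)"
    by (rule product_sigma_finite.intro) (rule lborel.sigma_finite_measure_axioms)
  define Q where "Q = split_nearest I1 I2 I3 X (i, j, k) (emb v) s r"
  define N where "N = {f \<in> space P. to_tensor I1 I2 I3 emb f \<in> Q}"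
  define I where "I = {..<I1} \<times> {..<I2} \<times> {..<I3} - {(i, j, k)}"
  have ins: "{..<I1} \<times> {..<I2} \<times> {..<I3} = insert (i, j, k) I" using e by (auto simp: I_def)
  have P: "P = PiM (insert (i, j, k) I) (\<lambda>_. (lborel :: 'a measure))" by (simp add: P_def ins)
  have fin: "finite I" "(i, j, k) \<notin> I" by (simp_all add: I_def)
  have tt: "to_tensor I1 I2 I3 emb \<in> borel_measurable P"
    unfolding P_def
    by (rule to_tensor_measurable) (intro borel_measurable_continuous_onI emb.continuous_on continuous_on_id)
  have "X \<noteq> {}" using ne(1) by auto
  then have "Q \<in> sets borel" unfolding Q_def by (rule split_nearest_borel[OF _ ne])
  from measurable_sets[OF tt this] have N: "N \<in> sets P"
    by (simp add: N_def vimage_def Int_def conj_commute)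
  have line_null: "(\<integral>\<^sup>+ y. indicator N (x((i, j, k) := y)) \<partial>lborel) = 0"
    if x: "x \<in> space (PiM I (\<lambda>_. (lborel :: 'a measure)))" for x
  proof -
    define A where "A = {y. x((i, j, k) := y) \<in> N}"
    have "(\<lambda>y. x((i, j, k) := y)) \<in> lborel \<rightarrow>\<^sub>M P"
      unfolding P using measurable_compose[OF measurable_Pair1'[OF x, of lborel] measurable_add_dim] by simp
    from measurable_sets[OF this N] have A: "A \<in> sets borel" by (simp add: A_def vimage_def)
    have "emeasure lborel A = 0"
    proof (rule emeasure_zero_of_disjoint_translates[OF A, of v])
      fix y t assume y: "y \<in> A" and t: "(t::real) > 0"
      let ?M = "to_tensor I1 I2 I3 emb (x((i, j, k) := y))"
      let ?M' = "to_tensor I1 I2 I3 emb (x((i, j, k) := y + t *\<^sub>R v))"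
      have "?M' i' j' k' = ?M i' j' k' + (if (i', j', k') = (i, j, k) then of_real t * emb v else 0)" for i' j' k'
        using e by (auto simp: to_tensor_def emb.add emb.scaleR scaleR_conv_of_real)
      moreover have "?M \<in> split_nearest I1 I2 I3 X (i, j, k) (emb v) s r"
        using y by (simp add: A_def N_def Q_def)
      ultimately have "?M' \<notin> split_nearest I1 I2 I3 X (i, j, k) (emb v) s r"
        by (rule split_nearest_line[OF e _ t sr ne])
      then show "y + t *\<^sub>R v \<notin> A" by (simp add: A_def N_def Q_def)
    qed
    moreover have "(\<integral>\<^sup>+ y. indicator N (x((i, j, k) := y)) \<partial>lborel) = (\<integral>\<^sup>+ y. indicator A y \<partial>lborel)"
      by (intro nn_integral_cong) (simp add: A_def indicator_def)
    ultimately show ?thesis using A by simp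
  qed
  have "emeasure P N = (\<integral>\<^sup>+ f. indicator N f \<partial>P)" using N by simp
  also have "\<dots> = (\<integral>\<^sup>+ x. (\<integral>\<^sup>+ y. indicator N (x((i, j, k) := y)) \<partial>lborel) \<partial>PiM I (\<lambda>_. (lborel :: 'a measure)))"
    unfolding P by (rule product_nn_integral_insert[OF fin]) (use N P in simp)
  also have "\<dots> = (\<integral>\<^sup>+ x. 0 \<partial>PiM I (\<lambda>_. (lborel :: 'a measure)))"
    by (intro nn_integral_cong line_null)
  finally show ?thesis using N by (auto simp: null_sets_def N_def Q_def)
qed

text \<open>Two distinct nearest points differ in some entry, and some direction in
  \<open>Vs\<close> sees the difference; rationals s < r between the two values reduce the covering
  of \<open>S\<close> to countably many null sets.\<close>

lemma nonunique_nearest_null: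
  fixes emb :: "'a::euclidean_space \<Rightarrow> complex"
  assumes emb: "bounded_linear emb" and Vs: "finite Vs"
    and sep: "\<And>y z. y \<in> F \<Longrightarrow> z \<in> F \<Longrightarrow> y \<noteq> z \<Longrightarrow> \<exists>v\<in>Vs. Re (cnj (emb v) * y) \<noteq> Re (cnj (emb v) * z)"
    and X: "\<And>T. T \<in> X \<Longrightarrow> tensor_in F I1 I2 I3 T"
    and S: "\<And>M. M \<in> S \<Longrightarrow> \<exists>T1 T2. T1 \<in> X \<and> T2 \<in> X \<and> T1 \<noteq> T2 \<and>
      (\<forall>T\<in>X. frob_dist I1 I2 I3 M T1 \<le> frob_dist I1 I2 I3 M T) \<and>
      (\<forall>T\<in>X. frob_dist I1 I2 I3 M T2 \<le> frob_dist I1 I2 I3 M T)"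
  defines "P \<equiv> PiM ({..<I1} \<times> {..<I2} \<times> {..<I3}) (\<lambda>_. (lborel :: 'a measure))"
  shows "\<exists>N \<in> null_sets P. {f \<in> space P. to_tensor I1 I2 I3 emb f \<in> S} \<subseteq> N"
proof -
  define lo where "lo i j k v s = {T \<in> X. Re (cnj (emb v) * T i j k) \<le> s}" for i j k v s
  define hi where "hi i j k v r = {T \<in> X. r \<le> Re (cnj (emb v) * T i j k)}" for i j k v r
  \<comment> \<open>Both half families must be nonempty, since an infimum over the empty set carries
    no information.\<close>
  define J where "J = {((i, j, k), v, s, r) | i j k v s r. i < I1 \<and> j < I2 \<and> k < I3 \<and> v \<in> Vs \<and>
      s \<in> \<rat> \<and> r \<in> \<rat> \<and> s < r \<and> lo i j k v s \<noteq> {} \<and> hi i j k v r \<noteq> {}}"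
  define B where "B = (\<lambda>(e, v, s, r).
      {f \<in> space P. to_tensor I1 I2 I3 emb f \<in> split_nearest I1 I2 I3 X e (emb v) s r})"
  have "J \<subseteq> ({..<I1} \<times> {..<I2} \<times> {..<I3}) \<times> Vs \<times> \<rat> \<times> \<rat>" by (auto simp: J_def)
  moreover have "countable (({..<I1} \<times> {..<I2} \<times> {..<I3}) \<times> Vs \<times> (\<rat> :: real set) \<times> (\<rat> :: real set))"
    using Vs by (intro countable_SIGMA countable_rat) (auto intro: countable_finite)
  ultimately have "countable J" using countable_subset by blast
  moreover have "B x \<in> null_sets P" if "x \<in> J" for x
    using that unfolding J_def B_def P_def lo_def hi_def
    by (auto intro!: split_nearest_null[OF emb])
  ultimately have "(\<Union>x\<in>J. B x) \<in> null_sets P" by (rule null_sets_UN')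
  moreover have "f \<in> (\<Union>x\<in>J. B x)" if f: "f \<in> space P" and fS: "to_tensor I1 I2 I3 emb f \<in> S" for f
  proof -
    let ?M = "to_tensor I1 I2 I3 emb f"
    obtain T1 T2 where T12: "T1 \<in> X" "T2 \<in> X" "T1 \<noteq> T2"
      and m1: "\<forall>T\<in>X. frob_dist I1 I2 I3 ?M T1 \<le> frob_dist I1 I2 I3 ?M T"
      and m2: "\<forall>T\<in>X. frob_dist I1 I2 I3 ?M T2 \<le> frob_dist I1 I2 I3 ?M T"
      using S[OF fS] by blast
    obtain i j k where ne: "T1 i j k \<noteq> T2 i j k" using T12(3) by (meson ext)
    have in1: "tensor_in F I1 I2 I3 T1" and in2: "tensor_in F I1 I2 I3 T2" using X T12 by auto
    have e: "i < I1" "j < I2" "k < I3"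
      using ne in1 in2 unfolding tensor_in_def by metis+
    have "T1 i j k \<in> F" "T2 i j k \<in> F" using e in1 in2 unfolding tensor_in_def by metis+
    then obtain v where v: "v \<in> Vs" "Re (cnj (emb v) * T1 i j k) \<noteq> Re (cnj (emb v) * T2 i j k)"
      using sep ne by blast
    have goal: "f \<in> (\<Union>x\<in>J. B x)"
      if S12: "S1 \<in> X" "S2 \<in> X" "Re (cnj (emb v) * S1 i j k) < Re (cnj (emb v) * S2 i j k)"
        and n1: "\<forall>T\<in>X. frob_dist I1 I2 I3 ?M S1 \<le> frob_dist I1 I2 I3 ?M T"
        and n2: "\<forall>T\<in>X. frob_dist I1 I2 I3 ?M S2 \<le> frob_dist I1 I2 I3 ?M T" for S1 S2
    proof -
      obtain s where s: "s \<in> \<rat>" "Re (cnj (emb v) * S1 i j k) < s" "s < Re (cnj (emb v) * S2 i j k)"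
        using Rats_dense_in_real[OF S12(3)] by blast
      obtain r where r: "r \<in> \<rat>" "s < r" "r < Re (cnj (emb v) * S2 i j k)"
        using Rats_dense_in_real[OF s(3)] by blast
      have S1: "S1 \<in> lo i j k v s" and S2: "S2 \<in> hi i j k v r"
        using S12 s r by (auto simp: lo_def hi_def)
      then have J: "((i, j, k), v, s, r) \<in> J" using e v s r by (auto simp: J_def)
      have a1: "inf_sq_dist I1 I2 I3 X ?M = (frob_dist I1 I2 I3 ?M S1)\<^sup>2"
        using n1 by (intro inf_sq_dist_attained[OF S12(1)]) auto
      have a2: "inf_sq_dist I1 I2 I3 X ?M = (frob_dist I1 I2 I3 ?M S2)\<^sup>2"
        using n2 by (intro inf_sq_dist_attained[OF S12(2)]) auto
      have a3: "inf_sq_dist I1 I2 I3 (lo i j k v s) ?M = (frob_dist I1 I2 I3 ?M S1)\<^sup>2"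
        using n1 by (intro inf_sq_dist_attained[OF S1]) (auto simp: lo_def)
      have a4: "inf_sq_dist I1 I2 I3 (hi i j k v r) ?M = (frob_dist I1 I2 I3 ?M S2)\<^sup>2"
        using n2 by (intro inf_sq_dist_attained[OF S2]) (auto simp: hi_def)
      have "?M \<in> split_nearest I1 I2 I3 X (i, j, k) (emb v) s r"
        unfolding split_nearest_def using a1 a2 a3 a4 by (simp add: lo_def hi_def)
      then have "f \<in> B ((i, j, k), v, s, r)" using f by (simp add: B_def)
      then show ?thesis using J by blast
    qed
    show ?thesis
      using v(2) goal[of T1 T2] goal[of T2 T1] T12 m1 m2 by (meson linorder_neqE_linordered_idom)
  qed
  ultimately show ?thesis by (intro bexI[of _ "\<Union>x\<in>J. B x"]) auto
qed

theorem theorem2p7: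
  fixes isreal :: bool and I1 I2 I3 R :: nat
  assumes "R \<le> min I1 I2"
  shows "(\<forall>M' W' W U eps. thm27_hyps isreal I1 I2 I3 R M' W' W U eps \<longrightarrow>
            (\<exists>T. best_approx (Kfield isreal) I1 I2 I3 R M' T) \<and>
            (\<forall>T. best_approx (Kfield isreal) I1 I2 I3 R M' T \<longrightarrow>
                 unique_CPD (Kfield isreal) I1 I2 I3 T)) \<and>
         tensor_null isreal I1 I2 I3
           {M'. (\<exists>W' W U eps. thm27_hyps isreal I1 I2 I3 R M' W' W U eps) \<and>
                \<not> (\<exists>!T. best_approx (Kfield isreal) I1 I2 I3 R M' T)}"
proof -
  let ?F = "Kfield isreal"
  define X where "X = {T. tensor_in ?F I1 I2 I3 T \<and> krank ?F I1 I2 I3 T \<le> R}"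
  have part1: "(\<exists>T. best_approx ?F I1 I2 I3 R M T) \<and>
      (\<forall>T. best_approx ?F I1 I2 I3 R M T \<longrightarrow> unique_CPD ?F I1 I2 I3 T)"
    if hyps: "thm27_hyps isreal I1 I2 I3 R M W' W U eps" for M W' W U eps
  proof -
    obtain p q T0 where pq: "\<forall>\<alpha> i. p \<alpha> i \<in> ?F" "\<forall>\<beta> j. q \<beta> j \<in> ?F"
      and M: "tensor_in ?F I1 I2 I3 M"
      and T0: "tensor_in ?F I1 I2 I3 T0" "krank ?F I1 I2 I3 T0 \<le> R"
      and pencil: "\<forall>T. tensor_in ?F I1 I2 I3 T \<and> frob_dist I1 I2 I3 M T \<le> frob_dist I1 I2 I3 M T0 \<longrightarrow>
        (\<exists>h0 h1. (\<forall>k. h0 k \<in> ?F) \<and> (\<forall>k. h1 k \<in> ?F) \<and>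
          simple_tensor ?F R 2 (pencil (weighted I3 h0 (modal_slice I1 I2 p q T))
            (weighted I3 h1 (modal_slice I1 I2 p q T))))"
      by (rule hyps_simple_pencil[OF hyps])
    have "krank ?F I1 I2 I3 T \<le> R"
      if "T \<in> closure X" "tensor_in ?F I1 I2 I3 T"
        "frob_dist I1 I2 I3 M T \<le> frob_dist I1 I2 I3 M T0" for T
      using pencil[rule_format, OF conjI[OF that(2,3)]]
        closure_krank_le[OF that(1)[unfolded X_def] that(2) pq] by blast
    then have "\<exists>T. best_approx ?F I1 I2 I3 R M T"
      unfolding X_def by (rule best_approx_exists[OF M T0])
    moreover have "unique_CPD ?F I1 I2 I3 T" if "best_approx ?F I1 I2 I3 R M T" for T
    proof -
      have T: "tensor_in ?F I1 I2 I3 T" "krank ?F I1 I2 I3 T \<le> R"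
        "frob_dist I1 I2 I3 M T \<le> frob_dist I1 I2 I3 M T0"
        using that T0 unfolding best_approx_def by blast+
      show ?thesis
        using pencil[rule_format, OF conjI[OF T(1,3)]]
          simple_pencil_unique_CPD[OF T(1,2) refl] by blast
    qed
    ultimately show ?thesis by blast
  qed
  define S where "S = {M'. (\<exists>W' W U eps. thm27_hyps isreal I1 I2 I3 R M' W' W U eps) \<and>
                \<not> (\<exists>!T. best_approx ?F I1 I2 I3 R M' T)}"
  have two: "\<exists>T1 T2. T1 \<in> X \<and> T2 \<in> X \<and> T1 \<noteq> T2 \<and>
      (\<forall>T\<in>X. frob_dist I1 I2 I3 M T1 \<le> frob_dist I1 I2 I3 M T) \<and>
      (\<forall>T\<in>X. frob_dist I1 I2 I3 M T2 \<le> frob_dist I1 I2 I3 M T)" if MS: "M \<in> S" for M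
  proof -
    \<comment> \<open>Existence holds on \<open>S\<close>, so failure of uniqueness means two
      minimizers and never none.\<close>
    have "\<exists>T. best_approx ?F I1 I2 I3 R M T" "\<not> (\<exists>!T. best_approx ?F I1 I2 I3 R M T)"
      using MS part1 unfolding S_def by blast+
    then obtain T1 T2 where "best_approx ?F I1 I2 I3 R M T1" "best_approx ?F I1 I2 I3 R M T2" "T1 \<noteq> T2"
      by blast
    then show ?thesis
      unfolding best_approx_def X_def by (intro exI[of _ T1] exI[of _ T2]) simp
  qed
  have X: "tensor_in ?F I1 I2 I3 T" if "T \<in> X" for T using that by (simp add: X_def)
  have "tensor_null isreal I1 I2 I3 S"
  proof (cases isreal)
    case True
    \<comment> \<open>A single direction separates real entries; complex ones take the two axes 1
      and \<i>.\<close>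
    have sep: "\<exists>v\<in>{1::real}. Re (cnj (complex_of_real v) * y) \<noteq> Re (cnj (complex_of_real v) * z)"
      if "y \<in> ?F" "z \<in> ?F" "y \<noteq> z" for y z
      using that True by (auto simp: Kfield_def complex_is_Real_iff complex_eq_iff)
    have "\<exists>N\<in>null_sets (PiM ({..<I1} \<times> {..<I2} \<times> {..<I3}) (\<lambda>_. (lborel :: real measure))).
      {f \<in> space (PiM ({..<I1} \<times> {..<I2} \<times> {..<I3}) (\<lambda>_. (lborel :: real measure))).
          to_tensor I1 I2 I3 complex_of_real f \<in> S} \<subseteq> N"
      by (rule nonunique_nearest_null[OF bounded_linear_of_real _ sep X two]) simp
    then show ?thesis
      using True unfolding tensor_null_def Let_def to_tensor_def by simp
  next
    case False
    have sep: "\<exists>v\<in>{1, \<i>}. Re (cnj v * y) \<noteq> Re (cnj v * z)"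
      if "y \<in> ?F" "z \<in> ?F" "y \<noteq> z" for y z
    proof -
      have "Re y \<noteq> Re z \<or> Im y \<noteq> Im z" using that(3) by (simp add: complex_eq_iff)
      then show ?thesis by auto
    qed
    have "\<exists>N\<in>null_sets (PiM ({..<I1} \<times> {..<I2} \<times> {..<I3}) (\<lambda>_. (lborel :: complex measure))).
      {f \<in> space (PiM ({..<I1} \<times> {..<I2} \<times> {..<I3}) (\<lambda>_. (lborel :: complex measure))).
          to_tensor I1 I2 I3 (\<lambda>z. z) f \<in> S} \<subseteq> N"
      by (rule nonunique_nearest_null[OF bounded_linear_ident _ sep X two]) simp
    then show ?thesis
      using False unfolding tensor_null_def Let_def to_tensor_def by simp
  qed
  then show ?thesis using part1 unfolding S_def by (intro conjI allI impI) simp_all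
qed

end
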